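(* Let $a,b\in\mathbb{C}$ with $|a|\ge|b|>1$, and let $H_{a,b}=(\mathbb{C}^2\setminus\{0\})/\sim$, where $(z,w)\sim(az,bw)$, be the Hopf surface of class $1$. Set $k_1=\log|a|$, $k_2=\log|b|$, $\alpha=\frac{2k_1}{k_1+k_2}$. Let $\theta$ be the real smooth function on $\mathbb{C}^2\setminus\{0\}$ defined by $|z|^2e^{-k_1\theta/\pi}+|w|^2e^{-k_2\theta/\pi}=1$, let $\Phi=e^{\frac{k_1+k_2}{2\pi}\theta}$, and let $$\Delta=\alpha|z|^2\Phi^{-\alpha}+(2-\alpha)|w|^2\Phi^{\alpha-2}.$$ Then, on $H_{a,b}$, the Hermitian metric $$\omega=\Delta^3\left(\frac1\Phi\sqrt{-1}\,\partial\bar\partial\Phi-\frac12\sqrt{-1}\,\partial\bar\partial\log\Phi\right)$$ is Levi-Civita Ricci-flat, i.e. $\mathfrak{Ric}(\omega)=0$.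
   Context: The equivalence relation $\sim$ on $\mathbb{C}^2\setminus\{0\}$ is the one generated by $(z,w)\sim(az,bw)$, i.e. $H_{a,b}$ is the quotient by the infinite cyclic group generated by $(z,w)\mapsto(az,bw)$; expressions in $(z,w)$ on $\mathbb{C}^2\setminus\{0\}$ that are invariant under this group are regarded as objects on $H_{a,b}$. Let $(X,\omega)$ be a Hermitian manifold with $\omega=\sqrt{-1}\,h_{i\bar j}\,dz^i\wedge d\bar z^j$ in local holomorphic coordinates. The Levi-Civita connection $\nabla^{\mathrm{LC}}$ on the holomorphic tangent bundle $T^{1,0}X$ is the $\mathbb{C}$-linearly extended Levi-Civita connection of the background Riemannian metric on $T_{\mathbb C}X$, restricted to $T^{1,0}X$ and followed by the projection $T_{\mathbb C}X\to T^{1,0}X$. Its Christoffel symbols are $$\Gamma_{ij}^k=\tfrac12 h^{k\bar\ell}\Big(\frac{\partial h_{j\bar\ell}}{\partial z^i}+\frac{\partial h_{i\bar\ell}}{\partial z^j}\Big),\qquad \Gamma_{\bar ij}^k=\tfrac12 h^{k\bar\ell}\Big(\frac{\partial h_{j\bar\ell}}{\partial\bar z^i}-\frac{\partial h_{j\bar i}}{\partial\bar z^\ell}\Big),$$ and the $(1,1)$-components of its curvature are $$\mathfrak R_{i\bar jk}^{\ell}=-\Big(\frac{\partial\Gamma_{ik}^\ell}{\partial\bar z^j}-\frac{\partial\Gamma_{\bar jk}^\ell}{\partial z^i}+\Gamma_{ik}^s\Gamma_{\bar js}^\ell-\Gamma_{\bar jk}^s\Gamma_{si}^\ell\Big).$$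 The (first) Levi-Civita Ricci curvature is $\mathfrak{Ric}(\omega)=\sqrt{-1}\,\mathfrak R_{i\bar jk}^{k}\,dz^i\wedge d\bar z^j$. Equivalently, $\mathfrak{Ric}(\omega)=\mathrm{Ric}(\omega)-\frac12(\partial\partial^*\omega+\bar\partial\bar\partial^*\omega)$, where $\mathrm{Ric}(\omega)=-\sqrt{-1}\partial\bar\partial\log\det(h_{i\bar j})$ is the Chern-Ricci form and $\partial^*,\bar\partial^*$ are the formal adjoints of $\partial,\bar\partial$ with respect to $\omega$. *)

theory Defs
  imports "HOL-Analysis.Analysis"
begin

section \<open>Smoothness and Wirtinger derivatives\<close>

(* Ck_on and smooth_on are meant for open S only: the derivative is taken at x in the whole
   space, not within S.  On open S in finite dimension this is the usual C^k. *)
primrec Ck_on ::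
  "nat \<Rightarrow> 'a::euclidean_space set \<Rightarrow> ('a \<Rightarrow> 'b::real_normed_vector) \<Rightarrow> bool" where
  "Ck_on 0 S f \<longleftrightarrow> continuous_on S f"
| "Ck_on (Suc k) S f \<longleftrightarrow>
     (\<forall>x\<in>S. f differentiable (at x)) \<and>
     (\<forall>v. Ck_on k S (\<lambda>x. frechet_derivative f (at x) v))"

definition smooth_on ::
  "'a::euclidean_space set \<Rightarrow> ('a \<Rightarrow> 'b::real_normed_vector) \<Rightarrow> bool" where
  "smooth_on S f \<longleftrightarrow> (\<forall>k. Ck_on k S f)"

(* With z^i = x^i + \<i> y^i, the vectors axis i 1 and axis i \<i> are d/dx^i and d/dy^i. *)
definition dz :: "'n::finite \<Rightarrow> (complex^'n \<Rightarrow> complex) \<Rightarrow> complex^'n \<Rightarrow> complex" where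
  "dz i f p = (frechet_derivative f (at p) (axis i 1)
               - \<i> * frechet_derivative f (at p) (axis i \<i>)) / 2"

definition dzbar :: "'n::finite \<Rightarrow> (complex^'n \<Rightarrow> complex) \<Rightarrow> complex^'n \<Rightarrow> complex" where
  "dzbar i f p = (frechet_derivative f (at p) (axis i 1)
                  + \<i> * frechet_derivative f (at p) (axis i \<i>)) / 2"


section \<open>Hermitian metrics and their Levi-Civita Ricci curvature\<close>

(* A (1,1)-form  \<i> H_{i jbar} dz^i /\ dzbar^j  is represented by its coefficient matrix at each
   point, with  H p $ i $ j = H_{i jbar}(p). *)

definition ddbar :: "(complex^'n::finite \<Rightarrow> complex) \<Rightarrow> complex^'n \<Rightarrow> complex^'n^'n" where
  "ddbar f p = (\<chi> i j. dz i (dzbar j f) p)"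

definition hermitian_metric_on ::
  "(complex^'n::finite) set \<Rightarrow> (complex^'n \<Rightarrow> complex^'n^'n) \<Rightarrow> bool" where
  "hermitian_metric_on S h \<longleftrightarrow>
     smooth_on S h \<and>
     (\<forall>p\<in>S. (\<forall>i j. h p $ j $ i = cnj (h p $ i $ j)) \<and>
            (\<forall>v. v \<noteq> 0 \<longrightarrow> Re (\<Sum>i\<in>UNIV. \<Sum>j\<in>UNIV. h p $ i $ j * v $ i * cnj (v $ j)) > 0))"

(* Pullback of a (1,1)-form under a holomorphic map g. *)
definition pullback_form ::
  "(complex^'n::finite \<Rightarrow> complex^'n) \<Rightarrow> (complex^'n \<Rightarrow> complex^'n^'n) \<Rightarrow> complex^'n \<Rightarrow> complex^'n^'n"
  where
  "pullback_form g h p = (\<chi> i j. \<Sum>k\<in>UNIV. \<Sum>l\<in>UNIV.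
     h (g p) $ k $ l * dz i (\<lambda>q. g q $ k) p * cnj (dz j (\<lambda>q. g q $ l) p))"

(* h_inv h k l p = h^{k lbar}(p), normalised by h^{k lbar} h_{j lbar} = delta^k_j; it is therefore
   the (l,k) entry of the inverse of the matrix (h_{i jbar}). *)
definition h_inv ::
  "(complex^'n::finite \<Rightarrow> complex^'n^'n) \<Rightarrow> 'n \<Rightarrow> 'n \<Rightarrow> complex^'n \<Rightarrow> complex" where
  "h_inv h k l p = matrix_inv (h p) $ l $ k"

(* Christoffel symbols of the Levi-Civita connection of the background Riemannian metric, extended
   C-linearly, restricted to T^{1,0} and projected to T^{1,0}:
   lc_Gamma h i j k = Gamma_{i j}^k  and  lc_Gamma_bar h i j k = Gamma_{ibar j}^k. *)
definition lc_Gamma ::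
  "(complex^'n::finite \<Rightarrow> complex^'n^'n) \<Rightarrow> 'n \<Rightarrow> 'n \<Rightarrow> 'n \<Rightarrow> complex^'n \<Rightarrow> complex" where
  "lc_Gamma h i j k p = (1/2) * (\<Sum>l\<in>UNIV. h_inv h k l p *
     (dz i (\<lambda>q. h q $ j $ l) p + dz j (\<lambda>q. h q $ i $ l) p))"

definition lc_Gamma_bar ::
  "(complex^'n::finite \<Rightarrow> complex^'n^'n) \<Rightarrow> 'n \<Rightarrow> 'n \<Rightarrow> 'n \<Rightarrow> complex^'n \<Rightarrow> complex" where
  "lc_Gamma_bar h i j k p = (1/2) * (\<Sum>l\<in>UNIV. h_inv h k l p *
     (dzbar i (\<lambda>q. h q $ j $ l) p - dzbar l (\<lambda>q. h q $ j $ i) p))"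

(* lc_curvature h i j k l = R_{i jbar k}^l *)
definition lc_curvature ::
  "(complex^'n::finite \<Rightarrow> complex^'n^'n) \<Rightarrow> 'n \<Rightarrow> 'n \<Rightarrow> 'n \<Rightarrow> 'n \<Rightarrow> complex^'n \<Rightarrow> complex" where
  "lc_curvature h i j k l p =
     - (dzbar j (lc_Gamma h i k l) p - dz i (lc_Gamma_bar h j k l) p
        + (\<Sum>s\<in>UNIV. lc_Gamma h i k s p * lc_Gamma_bar h j s l p
                    - lc_Gamma_bar h j k s p * lc_Gamma h s i l p))"

definition lc_ricci :: "(complex^'n::finite \<Rightarrow> complex^'n^'n) \<Rightarrow> complex^'n \<Rightarrow> complex^'n^'n" where
  "lc_ricci h p = (\<chi> i j. \<Sum>k\<in>UNIV. lc_curvature h i j k k p)"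


section \<open>The Hopf surface\<close>

definition hopf_gen :: "complex \<Rightarrow> complex \<Rightarrow> complex^2 \<Rightarrow> complex^2" where
  "hopf_gen a b p = vector [a * p $ 1, b * p $ 2]"

definition hopf_rel :: "complex \<Rightarrow> complex \<Rightarrow> ((complex^2) \<times> (complex^2)) set" where
  "hopf_rel a b = {(p, q). p \<noteq> 0 \<and> q \<noteq> 0 \<and> equivclp (\<lambda>x y. y = hopf_gen a b x) p q}"

definition hopf_surface :: "complex \<Rightarrow> complex \<Rightarrow> (complex^2) set set" where
  "hopf_surface a b = (- {0}) // hopf_rel a b"

lemma equiv_hopf_rel: "equiv (- {0}) (hopf_rel a b)"
proof (rule equivI)
  show "hopf_rel a b \<subseteq> (- {0}) \<times> (- {0})"
    by (auto simp: hopf_rel_def)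
  show "refl_on (- {0}) (hopf_rel a b)"
    by (auto simp: hopf_rel_def refl_on_def)
  show "sym (hopf_rel a b)"
    by (auto simp: hopf_rel_def intro!: symI intro: equivclp_sym)
  show "trans (hopf_rel a b)"
    by (auto simp: hopf_rel_def intro!: transI intro: equivclp_trans)
qed

(* A tensor on the quotient is a tensor on C^2 - {0} invariant under the covering group, which is
   generated by hopf_gen a b.  The projection C^2 - {0} --> hopf_surface a b is a local
   biholomorphism, so near a point x of the quotient (z,w) are local holomorphic coordinates
   centred at any chosen lift p \<in> x. *)
definition hermitian_metric_on_hopf ::
  "complex \<Rightarrow> complex \<Rightarrow> (complex^2 \<Rightarrow> complex^2^2) \<Rightarrow> bool" where
  "hermitian_metric_on_hopf a b h \<longleftrightarrow>
     hermitian_metric_on (- {0}) h \<and>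
     (\<forall>p. p \<noteq> 0 \<longrightarrow> pullback_form (hopf_gen a b) h p = h p)"

definition lc_ricci_flat_on_hopf ::
  "complex \<Rightarrow> complex \<Rightarrow> (complex^2 \<Rightarrow> complex^2^2) \<Rightarrow> bool" where
  "lc_ricci_flat_on_hopf a b h \<longleftrightarrow> (\<forall>x\<in>hopf_surface a b. \<forall>p\<in>x. lc_ricci h p = 0)"


section \<open>The metric\<close>

definition hopf_k :: "complex \<Rightarrow> real" where
  "hopf_k c = ln (norm c)"

definition hopf_alpha :: "complex \<Rightarrow> complex \<Rightarrow> real" where
  "hopf_alpha a b = 2 * hopf_k a / (hopf_k a + hopf_k b)"

definition hopf_theta_eq :: "complex \<Rightarrow> complex \<Rightarrow> complex^2 \<Rightarrow> real \<Rightarrow> bool" where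
  "hopf_theta_eq a b p t \<longleftrightarrow>
     (norm (p $ 1))\<^sup>2 * exp (- hopf_k a * t / pi) + (norm (p $ 2))\<^sup>2 * exp (- hopf_k b * t / pi) = 1"

definition hopf_theta :: "complex \<Rightarrow> complex \<Rightarrow> complex^2 \<Rightarrow> real" where
  "hopf_theta a b p = (THE t. hopf_theta_eq a b p t)"

definition hopf_Phi :: "complex \<Rightarrow> complex \<Rightarrow> complex^2 \<Rightarrow> real" where
  "hopf_Phi a b p = exp ((hopf_k a + hopf_k b) / (2 * pi) * hopf_theta a b p)"

definition hopf_Delta :: "complex \<Rightarrow> complex \<Rightarrow> complex^2 \<Rightarrow> real" where
  "hopf_Delta a b p =
     hopf_alpha a b * (norm (p $ 1))\<^sup>2 * hopf_Phi a b p powr (- hopf_alpha a b)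
     + (2 - hopf_alpha a b) * (norm (p $ 2))\<^sup>2 * hopf_Phi a b p powr (hopf_alpha a b - 2)"

definition hopf_metric :: "complex \<Rightarrow> complex \<Rightarrow> complex^2 \<Rightarrow> complex^2^2" where
  "hopf_metric a b p = (\<chi> i j. complex_of_real ((hopf_Delta a b p) ^ 3) *
     (complex_of_real (1 / hopf_Phi a b p)
        * ddbar (\<lambda>q. complex_of_real (hopf_Phi a b q)) p $ i $ j
      - (1/2) * ddbar (\<lambda>q. complex_of_real (ln (hopf_Phi a b q))) p $ i $ j))"

end

theory Submission
  imports Defs
begin

text \<open>
  Put $\varphi = \log\Phi$, $\beta = 2 - \alpha$, $E = e^{-\alpha\varphi}$, $F = e^{-\beta\varphi}$,
  $u = |z|^2 E$ and $v = |w|^2 F$, so that $u + v = 1$ and $\Delta = \alpha u + \beta v$.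
      Differentiating
  $u + v = 1$ twice gives $\partial\varphi = \xi/\Delta$ and
  $\varphi_{i\bar j} = EF\,\eta_i\bar\eta_j/\Delta^3$ with $\xi = (\bar z E, \bar w F)$ and
  $\eta = (\beta w, -\alpha z)$. Hence
  $h_{i\bar j} = \frac12 EF\,\eta_i\bar\eta_j + \Delta\,\xi_i\bar\xi_j$, which is visibly positive
  definite, and $\det h = \frac12 EF\Delta^3$.

  In the trace of the curvature the quadratic terms cancel, so only
  $\Gamma_{ik}^k = \frac12\partial_i\log\det h + \frac12 h^{k\bar\ell}\partial_k h_{i\bar\ell}$ and
  $\Gamma_{\bar jk}^k = \frac12\partial_{\bar j}\log\det h - \frac12
      h^{k\bar\ell}\partial_{\bar\ell}h_{k\bar j}$
  matter. The conformal factor $\Delta^3$ is what makes the contraction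
  $h^{k\bar\ell}\partial_k h_{i\bar\ell}$ vanish; the Ricci form is then the commutator of
  $\partial_i$ and $\partial_{\bar j}$ applied to $\frac12\log\det h$.
\<close>

section \<open>Calculus of smooth functions\<close>

text \<open>Derivatives are taken in the ambient space, so openness of \<open>S\<close> is what
  forces functions agreeing on \<open>S\<close> to have equal derivatives there. The induction then
  passes to that pair of derivatives.\<close>

lemma Ck_on_cong:
  assumes "open S" "\<And>x. x \<in> S \<Longrightarrow> f x = g x" "Ck_on k S f"
  shows "Ck_on k S g"
  using assms(2,3)
proof (induction k arbitrary: f g)
  case 0
  then show ?case
    using continuous_on_cong by fastforce
next
  case (Suc k)
  have eq: "frechet_derivative f (at x) = frechet_derivative g (at x)"
    and diff: "g differentiable (at x)" if "x \<in> S" for x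
  proof -
    have "f differentiable (at x)"
      using Suc.prems(2) that by simp
    then have "(f has_derivative frechet_derivative f (at x)) (at x)"
      by (simp add: frechet_derivative_works)
    then have d: "(g has_derivative frechet_derivative f (at x)) (at x)"
      by (rule has_derivative_transform_within_open[OF _ assms(1) that]) (simp add: Suc.prems(1))
    then show "frechet_derivative f (at x) = frechet_derivative g (at x)"
      by (rule frechet_derivative_at)
    show "g differentiable (at x)"
      using d by (auto simp: differentiable_def)
  qed
  have "Ck_on k S (\<lambda>x. frechet_derivative g (at x) v)" for v
  proof -
    have "Ck_on k S (\<lambda>x. frechet_derivative f (at x) v)"
      using Suc.prems(2) by simp
    then show ?thesis
      by (rule Suc.IH[rotated]) (simp add: eq)
  qed
  then show ?case
    using diff by simp
qed

text \<open>Most closure properties below are inductions through this rule, which accepts any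
  explicit derivative formula valid on \<open>S\<close>.\<close>

lemma Ck_on_SucI:
  assumes "open S" "\<And>x. x \<in> S \<Longrightarrow> (f has_derivative f' x) (at x)"
    "\<And>v. Ck_on k S (\<lambda>x. f' x v)"
  shows "Ck_on (Suc k) S f"
proof -
  have "frechet_derivative f (at x) = f' x" if "x \<in> S" for x
    using frechet_derivative_at[OF assms(2)[OF that]] by simp
  then have "Ck_on k S (\<lambda>x. frechet_derivative f (at x) v)" for v
    by (intro Ck_on_cong[OF assms(1) _ assms(3)[of v]]) (simp del: Ck_on.simps)
  then show ?thesis
    using assms(2) by (auto simp: differentiable_def)
qed

lemma Ck_on_SucD:
  assumes "Ck_on (Suc k) S f"
  shows "x \<in> S \<Longrightarrow> (f has_derivative frechet_derivative f (at x)) (at x)"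
    and "Ck_on k S (\<lambda>x. frechet_derivative f (at x) v)"
  using assms by (auto simp: frechet_derivative_works)

text \<open>The product and chain rules leave a factor undifferentiated; its order must drop from
  \<open>Suc k\<close> to \<open>k\<close> before an induction hypothesis applies.\<close>

lemma Ck_on_Suc_imp: "Ck_on (Suc k) S f \<Longrightarrow> Ck_on k S f"
proof (induction k arbitrary: f)
  case 0
  then show ?case
    by (auto intro!: continuous_at_imp_continuous_on differentiable_imp_continuous_within)
next
  case (Suc k)
  have "Ck_on k S (\<lambda>x. frechet_derivative f (at x) v)" for v
    by (rule Suc.IH) (use Suc.prems in simp)
  then show ?case
    using Suc.prems by simp
qed

lemma Ck_on_const:
  assumes "open S"
  shows "Ck_on k S (\<lambda>x. c)"
proof (induction k arbitrary: c)
  case (Suc k)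
  show ?case
    by (rule Ck_on_SucI[OF assms]) (auto intro!: derivative_eq_intros Suc)
qed simp

lemma Ck_on_bounded_linear:
  assumes "open S" "bounded_linear f"
  shows "Ck_on k S f"
proof (cases k)
  case 0
  then show ?thesis
    using assms(2) by (auto intro: linear_continuous_on)
next
  case (Suc k)
  show ?thesis
    unfolding Suc
    by (rule Ck_on_SucI[OF assms(1) bounded_linear.has_derivative[OF assms(2) has_derivative_ident]])
      (rule Ck_on_const[OF assms(1)])
qed

lemma Ck_on_compose_bounded_linear:
  assumes "open S" "bounded_linear L" "Ck_on k S f"
  shows "Ck_on k S (\<lambda>x. L (f x))"
  using assms(3)
proof (induction k arbitrary: f)
  case 0
  then show ?case
    using assms(2) by (auto intro: bounded_linear.continuous_on)
next
  case (Suc k)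
  show ?case
    by (rule Ck_on_SucI[OF assms(1) bounded_linear.has_derivative[OF assms(2) Ck_on_SucD(1)[OF
        Suc.prems]]])
      (auto intro!: Suc.IH Ck_on_SucD(2)[OF Suc.prems])
qed

lemma Ck_on_add:
  assumes "open S" "Ck_on k S f" "Ck_on k S g"
  shows "Ck_on k S (\<lambda>x. f x + g x)"
  using assms(2,3)
proof (induction k arbitrary: f g)
  case 0
  then show ?case
    by (auto intro: continuous_intros)
next
  case (Suc k)
  show ?case
    by (rule Ck_on_SucI[OF assms(1)
          has_derivative_add[OF Ck_on_SucD(1)[OF Suc.prems(1)] Ck_on_SucD(1)[OF Suc.prems(2)]]])
      (auto intro!: Suc.IH Ck_on_SucD(2)[OF Suc.prems(1)] Ck_on_SucD(2)[OF Suc.prems(2)])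
qed

text \<open>One Leibniz induction serves both multiplication and the inner product.\<close>

lemma Ck_on_bounded_bilinear:
  assumes "open S" "bounded_bilinear pr" "Ck_on k S f" "Ck_on k S g"
  shows "Ck_on k S (\<lambda>x. pr (f x) (g x))"
  using assms(3,4)
proof (induction k arbitrary: f g)
  case 0
  then show ?case
    using bounded_bilinear.continuous_on[OF assms(2)] by auto
next
  case (Suc k)
  show ?case
    by (rule Ck_on_SucI[OF assms(1) bounded_bilinear.FDERIV[OF assms(2)
          Ck_on_SucD(1)[OF Suc.prems(1)] Ck_on_SucD(1)[OF Suc.prems(2)]]])
      (auto intro!: Ck_on_add[OF assms(1)] Suc.IH Ck_on_SucD(2)[OF Suc.prems(1)]
        Ck_on_SucD(2)[OF Suc.prems(2)] Ck_on_Suc_imp[OF Suc.prems(1)] Ck_on_Suc_imp[OF Suc.prems(2)])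
qed

lemmas Ck_on_mult = Ck_on_bounded_bilinear[OF _ bounded_bilinear_mult]

lemma Ck_on_uminus:
  assumes "open S" "Ck_on k S f"
  shows "Ck_on k S (\<lambda>x. - f x)"
  by (rule Ck_on_compose_bounded_linear[OF assms(1) bounded_linear_minus[OF bounded_linear_ident]
      assms(2)])

text \<open>A bootstrap: the derivative is \<open>exp (f x)\<close> times the derivative of
  \<open>f\<close>, so order \<open>k\<close> of both factors yields order \<open>Suc k\<close>.
  \<open>Ck_on_inverse\<close> follows the same pattern.\<close>

lemma Ck_on_exp:
  fixes f :: "'a::euclidean_space \<Rightarrow> 'b::{real_normed_field,banach}"
  assumes "open S" "Ck_on k S f"
  shows "Ck_on k S (\<lambda>x. exp (f x))"
  using assms(2)
proof (induction k)
  case 0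
  then show ?case
    by (auto intro: continuous_intros)
next
  case (Suc k)
  have "((\<lambda>x. exp (f x)) has_derivative (\<lambda>v. exp (f x) * frechet_derivative f (at x) v)) (at x)"
    if "x \<in> S" for x
    using has_derivative_compose[OF Ck_on_SucD(1)[OF Suc.prems that]
        DERIV_exp[unfolded has_field_derivative_def]] .
  then show ?case
    by (rule Ck_on_SucI[OF assms(1)])
      (auto intro!: Ck_on_mult[OF assms(1)] Suc.IH Ck_on_SucD(2)[OF Suc.prems] Ck_on_Suc_imp[OF
          Suc.prems])
qed

lemma Ck_on_inverse:
  fixes f :: "'a::euclidean_space \<Rightarrow> 'b::real_normed_field"
  assumes "open S" "Ck_on k S f" "\<And>x. x \<in> S \<Longrightarrow> f x \<noteq> 0"
  shows "Ck_on k S (\<lambda>x. inverse (f x))"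
  using assms(2)
proof (induction k)
  case 0
  then show ?case
    using assms(3) by (auto intro: continuous_intros)
next
  case (Suc k)
  have "((\<lambda>x. inverse (f x)) has_derivative
      (\<lambda>v. - (inverse (f x) * frechet_derivative f (at x) v * inverse (f x)))) (at x)" if "x \<in> S" for x
    using Deriv.has_derivative_inverse[OF assms(3)[OF that] Ck_on_SucD(1)[OF Suc.prems that]] .
  then show ?case
    by (rule Ck_on_SucI[OF assms(1)])
      (assumption | intro Ck_on_uminus Ck_on_mult assms(1) Suc.IH Ck_on_SucD(2)[OF Suc.prems]
        Ck_on_Suc_imp[OF Suc.prems])+
qed

lemma smooth_on_cong:
  assumes "open S" "\<And>x. x \<in> S \<Longrightarrow> f x = g x" "smooth_on S f"
  shows "smooth_on S g"
  using assms Ck_on_cong unfolding smooth_on_def by metis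

lemma smooth_on_const: "open S \<Longrightarrow> smooth_on S (\<lambda>x. c)"
  by (simp add: smooth_on_def Ck_on_const)

lemma smooth_on_bounded_linear: "open S \<Longrightarrow> bounded_linear f \<Longrightarrow> smooth_on S f"
  by (simp add: smooth_on_def Ck_on_bounded_linear)

lemma smooth_on_compose_bounded_linear:
  "open S \<Longrightarrow> bounded_linear L \<Longrightarrow> smooth_on S f \<Longrightarrow> smooth_on S (\<lambda>x. L (f x))"
  by (simp add: smooth_on_def Ck_on_compose_bounded_linear)

lemma smooth_on_add:
  "open S \<Longrightarrow> smooth_on S f \<Longrightarrow> smooth_on S g \<Longrightarrow> smooth_on S (\<lambda>x. f x + g x)"
  by (simp add: smooth_on_def Ck_on_add)

lemma smooth_on_uminus: "open S \<Longrightarrow> smooth_on S f \<Longrightarrow> smooth_on S (\<lambda>x. - f x)"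
  by (simp add: smooth_on_def Ck_on_uminus)

lemma smooth_on_diff:
  "open S \<Longrightarrow> smooth_on S f \<Longrightarrow> smooth_on S g \<Longrightarrow> smooth_on S (\<lambda>x. f x - g x)"
  using smooth_on_add[of S f "\<lambda>x. - g x"] by (simp add: smooth_on_uminus)

lemma smooth_on_mult:
  fixes f g :: "'a::euclidean_space \<Rightarrow> 'b::real_normed_algebra"
  shows "open S \<Longrightarrow> smooth_on S f \<Longrightarrow> smooth_on S g \<Longrightarrow> smooth_on S (\<lambda>x. f x * g x)"
  by (simp add: smooth_on_def Ck_on_mult)

lemma smooth_on_divide:
  fixes f g :: "'a::euclidean_space \<Rightarrow> 'b::real_normed_field"
  assumes "open S" "smooth_on S f" "smooth_on S g" "\<And>x. x \<in> S \<Longrightarrow> g x \<noteq> 0"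
  shows "smooth_on S (\<lambda>x. f x / g x)"
  using assms by (simp add: smooth_on_def divide_inverse Ck_on_mult Ck_on_inverse)

lemma smooth_on_exp:
  fixes f :: "'a::euclidean_space \<Rightarrow> 'b::{real_normed_field,banach}"
  shows "open S \<Longrightarrow> smooth_on S f \<Longrightarrow> smooth_on S (\<lambda>x. exp (f x))"
  by (simp add: smooth_on_def Ck_on_exp)

lemma smooth_on_sum:
  "open S \<Longrightarrow> (\<And>i. i \<in> I \<Longrightarrow> smooth_on S (f i)) \<Longrightarrow> smooth_on S (\<lambda>x. \<Sum>i\<in>I. f i x)"
  by (induction I rule: infinite_finite_induct) (auto intro: smooth_on_const smooth_on_add)

lemma smooth_on_frechet_derivative:
  "smooth_on S f \<Longrightarrow> smooth_on S (\<lambda>x. frechet_derivative f (at x) v)"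
  unfolding smooth_on_def by (metis Ck_on_SucD(2))

lemma smooth_on_imp_differentiable: "smooth_on S f \<Longrightarrow> x \<in> S \<Longrightarrow> f differentiable (at x)"
  unfolding smooth_on_def by (metis Ck_on.simps(2))

lemma smooth_on_dz: "open S \<Longrightarrow> smooth_on S f \<Longrightarrow> smooth_on S (dz i f)"
  unfolding dz_def
  by (intro smooth_on_divide smooth_on_diff smooth_on_mult smooth_on_const
      smooth_on_frechet_derivative) auto

lemma smooth_on_dzbar: "open S \<Longrightarrow> smooth_on S f \<Longrightarrow> smooth_on S (dzbar i f)"
  unfolding dzbar_def
  by (intro smooth_on_divide smooth_on_add smooth_on_mult smooth_on_const
      smooth_on_frechet_derivative) auto

text \<open>A matrix is the sum of its entries embedded by the linear maps
  \<open>axis i (axis j c)\<close>, so closure under linear maps and finite sums suffices.\<close>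

lemma smooth_on_matrix:
  fixes h :: "'a::euclidean_space \<Rightarrow> complex^'n::finite^'m::finite"
  assumes "open S" "\<And>i j. smooth_on S (\<lambda>x. h x $ i $ j)"
  shows "smooth_on S h"
proof -
  have lin: "bounded_linear (\<lambda>c::complex. axis i (axis j c) :: complex^'n^'m)" for i j
    by (rule linear_conv_bounded_linear[THEN iffD1])
      (auto intro!: linearI simp: axis_def vec_eq_iff)
  have "smooth_on S (\<lambda>x. \<Sum>i\<in>UNIV. \<Sum>j\<in>UNIV. axis i (axis j (h x $ i $ j)) :: complex^'n^'m)"
    by (intro smooth_on_sum assms(1) smooth_on_compose_bounded_linear[OF assms(1) lin] assms(2))
  moreover have "(\<Sum>i\<in>UNIV. \<Sum>j\<in>UNIV. axis i (axis j (A $ i $ j))) = A" for A :: "complex^'n^'m"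
  proof -
    have "(\<Sum>j\<in>UNIV. axis i (axis j (A $ i $ j))) $ k $ l = (if i = k then A $ i $ l else 0)" for i k l
      by (cases "i = k") (simp_all add: axis_def)
    then show ?thesis
      by (simp add: vec_eq_iff)
  qed
  ultimately show ?thesis
    by simp
qed

section \<open>Wirtinger derivatives in two variables\<close>

text \<open>The real differential is expanded in dz^1, dz^2, dzbar^1, dzbar^2. Carrying all four
  coefficients together lets the usual differentiation rules compute \<open>dz\<close> and
  \<open>dzbar\<close> at once.\<close>

definition has_wirtinger ::
  "(complex^2 \<Rightarrow> complex) \<Rightarrow> complex \<Rightarrow> complex \<Rightarrow> complex \<Rightarrow> complex \<Rightarrow> complex^2 \<Rightarrow> bool" where
  "has_wirtinger f a1 a2 b1 b2 p \<longleftrightarrow>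
     (f has_derivative (\<lambda>v. a1 * v $ 1 + a2 * v $ 2 + b1 * cnj (v $ 1) + b2 * cnj (v $ 2))) (at p)"

lemma has_wirtinger_imp_dz:
  assumes "has_wirtinger f a1 a2 b1 b2 p"
  shows "dz 1 f p = a1" "dz 2 f p = a2" "dzbar 1 f p = b1" "dzbar 2 f p = b2"
proof -
  have *: "frechet_derivative f (at p) =
      (\<lambda>v. a1 * v $ 1 + a2 * v $ 2 + b1 * cnj (v $ 1) + b2 * cnj (v $ 2))"
    using frechet_derivative_at[OF assms[unfolded has_wirtinger_def]] by (rule sym)
  have axis: "(axis 1 x :: complex^2) $ 1 = x" "(axis 2 x :: complex^2) $ 2 = x" "(axis 1 x ::
      complex^2) $ 2 = 0" "(axis 2 x :: complex^2) $ 1 = 0"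
    for x :: complex
    by (simp_all add: axis_def)
  \<comment> \<open>On \<open>axis i 1\<close> and \<open>axis i \<i>\<close> the differential takes
    the values a + b and a \<i> - b \<i>; these combinations recover a and b.\<close>
  have "(a + b - \<i> * (a * \<i> - b * \<i>)) / 2 = a" "(a + b + \<i> * (a * \<i> - b * \<i>)) / 2 = b" for a b
    by (simp_all add: right_diff_distrib mult.left_commute[of \<i>])
  then show "dz 1 f p = a1" "dz 2 f p = a2" "dzbar 1 f p = b1" "dzbar 2 f p = b2"
    unfolding dz_def dzbar_def * axis by simp_all
qed

lemma has_wirtinger_eq_rhs:
  assumes "has_wirtinger f a1 a2 b1 b2 p" "a1 = a1'" "a2 = a2'" "b1 = b1'" "b2 = b2'"
  shows "has_wirtinger f a1' a2' b1' b2' p"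
  using assms by simp

lemma has_wirtinger_transform_within_open:
  assumes "has_wirtinger f a1 a2 b1 b2 p" "open S" "p \<in> S" "\<And>q. q \<in> S \<Longrightarrow> f q = g q"
  shows "has_wirtinger g a1 a2 b1 b2 p"
  using has_derivative_transform_within_open[OF assms(1)[unfolded has_wirtinger_def] assms(2-4)]
  by (simp add: has_wirtinger_def)

lemma has_wirtinger_const: "has_wirtinger (\<lambda>q. c) 0 0 0 0 p"
  by (simp add: has_wirtinger_def)

lemma has_wirtinger_nth:
  "has_wirtinger (\<lambda>q. q $ 1) 1 0 0 0 p" "has_wirtinger (\<lambda>q. q $ 2) 0 1 0 0 p"
  unfolding has_wirtinger_def
  by (auto intro!: derivative_eq_intros bounded_linear.has_derivative[OF bounded_linear_vec_nth])

lemma has_wirtinger_cnj: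
  assumes "has_wirtinger f a1 a2 b1 b2 p"
  shows "has_wirtinger (\<lambda>q. cnj (f q)) (cnj b1) (cnj b2) (cnj a1) (cnj a2) p"
  using bounded_linear.has_derivative[OF bounded_linear_cnj assms[unfolded has_wirtinger_def]]
  unfolding has_wirtinger_def
  by (rule has_derivative_eq_rhs) (auto simp: algebra_simps)

lemma has_wirtinger_add:
  assumes "has_wirtinger f a1 a2 b1 b2 p" "has_wirtinger g c1 c2 d1 d2 p"
  shows "has_wirtinger (\<lambda>q. f q + g q) (a1 + c1) (a2 + c2) (b1 + d1) (b2 + d2) p"
  using has_derivative_add[OF assms[unfolded has_wirtinger_def]]
  unfolding has_wirtinger_def
  by (rule has_derivative_eq_rhs) (auto simp: algebra_simps)

lemma has_wirtinger_diff:
  assumes "has_wirtinger f a1 a2 b1 b2 p" "has_wirtinger g c1 c2 d1 d2 p"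
  shows "has_wirtinger (\<lambda>q. f q - g q) (a1 - c1) (a2 - c2) (b1 - d1) (b2 - d2) p"
  using has_derivative_diff[OF assms[unfolded has_wirtinger_def]]
  unfolding has_wirtinger_def
  by (rule has_derivative_eq_rhs) (auto simp: algebra_simps)

lemma has_wirtinger_mult:
  assumes "has_wirtinger f a1 a2 b1 b2 p" "has_wirtinger g c1 c2 d1 d2 p"
  shows "has_wirtinger (\<lambda>q. f q * g q)
    (f p * c1 + a1 * g p) (f p * c2 + a2 * g p) (f p * d1 + b1 * g p) (f p * d2 + b2 * g p) p"
  using has_derivative_mult[OF assms[unfolded has_wirtinger_def]]
  unfolding has_wirtinger_def
  by (rule has_derivative_eq_rhs) (auto simp: algebra_simps)

text \<open>The outer function is holomorphic, so its differential is multiplication by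
  \<open>d\<close>, and barred and unbarred coefficients do not mix.\<close>

lemma has_wirtinger_compose:
  assumes "has_wirtinger f a1 a2 b1 b2 p" "(g has_field_derivative d) (at (f p))"
  shows "has_wirtinger (\<lambda>q. g (f q)) (d * a1) (d * a2) (d * b1) (d * b2) p"
  using has_derivative_compose[OF assms(1)[unfolded has_wirtinger_def]
      assms(2)[unfolded has_field_derivative_def]]
  unfolding has_wirtinger_def
  by (rule has_derivative_eq_rhs) (auto simp: algebra_simps)

lemma has_wirtinger_exp:
  assumes "has_wirtinger f a1 a2 b1 b2 p"
  shows "has_wirtinger (\<lambda>q. exp (f q))
    (exp (f p) * a1) (exp (f p) * a2) (exp (f p) * b1) (exp (f p) * b2) p"
  by (rule has_wirtinger_compose[OF assms DERIV_exp])

lemma has_wirtinger_inverse: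
  assumes "has_wirtinger f a1 a2 b1 b2 p" "f p \<noteq> 0"
  shows "has_wirtinger (\<lambda>q. inverse (f q))
    (- (a1 / (f p)\<^sup>2)) (- (a2 / (f p)\<^sup>2)) (- (b1 / (f p)\<^sup>2)) (- (b2 / (f p)\<^sup>2)) p"
  using has_wirtinger_compose[OF assms(1) DERIV_inverse[OF assms(2)]]
  by (rule has_wirtinger_eq_rhs) (simp_all add: field_simps power2_eq_square)

lemma has_wirtinger_divide:
  assumes "has_wirtinger f a1 a2 b1 b2 p" "has_wirtinger g c1 c2 d1 d2 p" "g p \<noteq> 0"
  shows "has_wirtinger (\<lambda>q. f q / g q)
    ((a1 * g p - f p * c1) / (g p)\<^sup>2) ((a2 * g p - f p * c2) / (g p)\<^sup>2)
    ((b1 * g p - f p * d1) / (g p)\<^sup>2) ((b2 * g p - f p * d2) / (g p)\<^sup>2) p"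
  unfolding divide_inverse[of "f _"]
  by (rule has_wirtinger_eq_rhs[OF has_wirtinger_mult[OF assms(1) has_wirtinger_inverse[OF
      assms(2,3)]]])
    (use assms(3) in \<open>simp_all add: field_simps power2_eq_square\<close>)

section \<open>The trace of the Levi-Civita curvature\<close>

text \<open>Differentiability is not assumed: both functions satisfy \<open>has_derivative\<close>
  for the same candidates, so the choice operator returns the same value.\<close>

lemma frechet_derivative_cong_open:
  assumes "open S" "p \<in> S" "\<And>q. q \<in> S \<Longrightarrow> f q = g q"
  shows "frechet_derivative f (at p) = frechet_derivative g (at p)"
proof -
  have "(f has_derivative f') (at p) = (g has_derivative f') (at p)" for f'
    using has_derivative_transform_within_open[OF _ assms(1,2), of f f' _ g]
      has_derivative_transform_within_open[OF _ assms(1,2), of g f' _ f] assms(3) by auto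
  then show ?thesis
    by (simp add: frechet_derivative_def)
qed

lemma dz_cong_open:
  assumes "open S" "p \<in> S" "\<And>q. q \<in> S \<Longrightarrow> f q = g q"
  shows "dz i f p = dz i g p" "dzbar i f p = dzbar i g p"
  using frechet_derivative_cong_open[of S p f g] assms by (simp_all add: dz_def dzbar_def)

text \<open>The Ricci form differentiates the metric twice. Hence the Christoffel symbols are first
  compared on all of \<open>S\<close>, and only then differentiated at \<open>p\<close>.\<close>

lemma lc_ricci_cong_open:
  assumes "open S" "p \<in> S" "\<And>q. q \<in> S \<Longrightarrow> h q = h' q"
  shows "lc_ricci h p = lc_ricci h' p"
proof -
  have d: "dz i (\<lambda>q. h q $ k $ l) q = dz i (\<lambda>q. h' q $ k $ l) q"
    "dzbar i (\<lambda>q. h q $ k $ l) q = dzbar i (\<lambda>q. h' q $ k $ l) q" if "q \<in> S" for i k l q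
    using dz_cong_open[OF assms(1) that, of "\<lambda>q. h q $ k $ l" "\<lambda>q. h' q $ k $ l"] assms(3) by simp_all
  have G: "lc_Gamma h i j k q = lc_Gamma h' i j k q"
    "lc_Gamma_bar h i j k q = lc_Gamma_bar h' i j k q" if "q \<in> S" for i j k q
    using that by (simp_all add: lc_Gamma_def lc_Gamma_bar_def h_inv_def d assms(3))
  have "dzbar j (lc_Gamma h i k l) p = dzbar j (lc_Gamma h' i k l) p"
    "dz j (lc_Gamma_bar h i k l) p = dz j (lc_Gamma_bar h' i k l) p" for i j k l
    by (intro dz_cong_open[OF assms(1,2)] G; assumption)+
  then show ?thesis
    using G[OF assms(2)] by (simp add: lc_ricci_def lc_curvature_def)
qed

lemma dz_sum:
  assumes "\<And>k. k \<in> A \<Longrightarrow> f k differentiable (at p)"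
  shows "dz i (\<lambda>q. \<Sum>k\<in>A. f k q) p = (\<Sum>k\<in>A. dz i (f k) p)"
    and "dzbar i (\<lambda>q. \<Sum>k\<in>A. f k q) p = (\<Sum>k\<in>A. dzbar i (f k) p)"
proof -
  have "((\<lambda>q. \<Sum>k\<in>A. f k q) has_derivative (\<lambda>v. \<Sum>k\<in>A. frechet_derivative (f k) (at p) v)) (at p)"
    using assms by (intro has_derivative_sum) (simp add: frechet_derivative_works)
  then have *: "frechet_derivative (\<lambda>q. \<Sum>k\<in>A. f k q) (at p) = (\<lambda>v.
      \<Sum>k\<in>A. frechet_derivative (f k) (at p) v)"
    by (rule frechet_derivative_at[symmetric])
  show "dz i (\<lambda>q. \<Sum>k\<in>A. f k q) p = (\<Sum>k\<in>A. dz i (f k) p)"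
    "dzbar i (\<lambda>q. \<Sum>k\<in>A. f k q) p = (\<Sum>k\<in>A. dzbar i (f k) p)"
    by (simp_all add: dz_def dzbar_def * sum_subtractf sum.distrib sum_distrib_left
        flip: sum_divide_distrib)
qed

lemma lc_Gamma_commute: "lc_Gamma h i j k p = lc_Gamma h j i k p"
  by (simp add: lc_Gamma_def add.commute)

text \<open>After setting k = l and summing, the two quadratic terms become equal on exchanging the
  names of k and s, by symmetry of \<open>lc_Gamma\<close> in its lower indices.\<close>

lemma lc_ricci_eq_traces:
  assumes "\<And>k. lc_Gamma h i k k differentiable (at p)" "\<And>k. lc_Gamma_bar h j k k differentiable (at p)"
  shows "lc_ricci h p $ i $ j =
    dz i (\<lambda>q. \<Sum>k\<in>UNIV. lc_Gamma_bar h j k k q) p - dzbar j (\<lambda>q. \<Sum>k\<in>UNIV. lc_Gamma h i k k q) p"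
proof -
  have "(\<Sum>k\<in>UNIV. \<Sum>s\<in>UNIV. lc_Gamma h i k s p * lc_Gamma_bar h j s k p) =
      (\<Sum>k\<in>UNIV. \<Sum>s\<in>UNIV. lc_Gamma_bar h j k s p * lc_Gamma h s i k p)"
    by (subst sum.swap) (simp add: lc_Gamma_commute[of h i] mult.commute)
  then show ?thesis
    by (simp add: lc_ricci_def lc_curvature_def dz_sum[OF assms(2)] dz_sum[OF assms(1)]
        sum.distrib sum_subtractf sum_negf)
qed

section \<open>Inverses of 2 by 2 matrices\<close>

lemma matrix_inv_2:
  fixes A :: "complex^2^2"
  assumes "A $ 1 $ 1 * A $ 2 $ 2 - A $ 1 $ 2 * A $ 2 $ 1 = d" "d \<noteq> 0"
  shows "matrix_inv A $ 1 $ 1 = A $ 2 $ 2 / d" "matrix_inv A $ 1 $ 2 = - A $ 1 $ 2 / d"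
    "matrix_inv A $ 2 $ 1 = - A $ 2 $ 1 / d" "matrix_inv A $ 2 $ 2 = A $ 1 $ 1 / d"
proof -
  define B :: "complex^2^2" where
    "B = vector [vector [A $ 2 $ 2 / d, - A $ 1 $ 2 / d], vector [- A $ 2 $ 1 / d, A $ 1 $ 1 / d]]"
  have AB: "A ** B = mat 1"
    using assms by (simp add: matrix_matrix_mult_def mat_def vec_eq_iff forall_2 sum_2 B_def)
      (auto simp: field_simps)
  have BA: "B ** A = mat 1"
    using assms by (simp add: matrix_matrix_mult_def mat_def vec_eq_iff forall_2 sum_2 B_def)
      (auto simp: field_simps)
  \<comment> \<open>\<open>matrix_inv\<close> is a Hilbert choice; the adjugate quotient
    \<open>B\<close> shows that a two-sided inverse exists, and associativity then identifies the
    chosen one with \<open>B\<close>.\<close>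
  have "A ** matrix_inv A = mat 1"
    unfolding matrix_inv_def using someI[of "\<lambda>B. A ** B = mat 1 \<and> B ** A = mat 1" B] AB BA by simp
  then have "B ** A ** matrix_inv A = B"
    by (simp flip: matrix_mul_assoc)
  then have "matrix_inv A = B"
    by (simp add: BA)
  then show "matrix_inv A $ 1 $ 1 = A $ 2 $ 2 / d" "matrix_inv A $ 1 $ 2 = - A $ 1 $ 2 / d"
    "matrix_inv A $ 2 $ 1 = - A $ 2 $ 1 / d" "matrix_inv A $ 2 $ 2 = A $ 1 $ 1 / d"
    by (simp_all add: B_def)
qed

lemma smooth_on_matrix_inv_2:
  fixes A :: "'a::euclidean_space \<Rightarrow> complex^2^2"
  assumes "open S" and smooth: "\<And>i j. smooth_on S (\<lambda>x. A x $ i $ j)"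
    and det: "\<And>x. x \<in> S \<Longrightarrow> A x $ 1 $ 1 * A x $ 2 $ 2 - A x $ 1 $ 2 * A x $ 2 $ 1 \<noteq> 0"
  shows "smooth_on S (\<lambda>x. matrix_inv (A x) $ i $ j)"
proof -
  define d where "d x = A x $ 1 $ 1 * A x $ 2 $ 2 - A x $ 1 $ 2 * A x $ 2 $ 1" for x
  have d: "smooth_on S d"
    unfolding d_def[abs_def] by (intro smooth_on_diff smooth_on_mult assms(1) smooth)
  have *: "smooth_on S (\<lambda>x. A x $ k $ l / d x)" "smooth_on S (\<lambda>x. - A x $ k $ l / d x)" for k l
    using det by (auto simp: d_def intro!: smooth_on_divide smooth_on_uminus smooth d assms(1) simp
        flip: d_def)
  have inv: "matrix_inv (A x) $ 1 $ 1 = A x $ 2 $ 2 / d x" "matrix_inv (A x) $ 1 $ 2 = - A x $ 1 $ 2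
      / d x"
    "matrix_inv (A x) $ 2 $ 1 = - A x $ 2 $ 1 / d x" "matrix_inv (A x) $ 2 $ 2 = A x $ 1 $ 1 / d x"
    if "x \<in> S" for x
    using matrix_inv_2[OF d_def[symmetric]] det[OF that] by (simp_all add: d_def)
  have "smooth_on S (\<lambda>x. matrix_inv (A x) $ 1 $ 1)"
    by (rule smooth_on_cong[OF assms(1) inv(1)[symmetric] *(1)])
  moreover have "smooth_on S (\<lambda>x. matrix_inv (A x) $ 1 $ 2)"
    by (rule smooth_on_cong[OF assms(1) inv(2)[symmetric] *(2)])
  moreover have "smooth_on S (\<lambda>x. matrix_inv (A x) $ 2 $ 1)"
    by (rule smooth_on_cong[OF assms(1) inv(3)[symmetric] *(2)])
  moreover have "smooth_on S (\<lambda>x. matrix_inv (A x) $ 2 $ 2)"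
    by (rule smooth_on_cong[OF assms(1) inv(4)[symmetric] *(1)])
  ultimately show ?thesis
    using exhaust_2[of i] exhaust_2[of j] by auto
qed

lemma hermitian_metric_on_cong:
  assumes "open S" "\<And>p. p \<in> S \<Longrightarrow> h p = h' p" "hermitian_metric_on S h"
  shows "hermitian_metric_on S h'"
  unfolding hermitian_metric_on_def
proof (intro conjI ballI)
  show "smooth_on S h'"
    using assms(3) smooth_on_cong[OF assms(1,2)] by (simp add: hermitian_metric_on_def)
  fix p assume p: "p \<in> S"
  show "\<forall>i j. h' p $ j $ i = cnj (h' p $ i $ j)"
    "\<forall>v. v \<noteq> 0 \<longrightarrow> Re (\<Sum>i\<in>UNIV. \<Sum>j\<in>UNIV. h' p $ i $ j * v $ i * cnj (v $ j)) > 0"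
    using assms(3) p unfolding hermitian_metric_on_def assms(2)[OF p, symmetric] by blast+
qed

section \<open>The potential\<close>

lemma open_punctured: "open (- {0 :: complex^2})"
  by auto

text \<open>Here \<phi> stands for log Phi. Rescaling \<theta> to \<phi> absorbs k_1, k_2 and pi
  into the exponents \<alpha> and \<beta>, so the local geometry depends on the implicit equation
  alone.\<close>

locale hopf_potential =
  fixes \<alpha> \<beta> :: real and \<phi> :: "complex^2 \<Rightarrow> real"
  assumes pos: "\<alpha> > 0" "\<beta> > 0" and sum_eq_2: "\<alpha> + \<beta> = 2"
    and potential: "p \<noteq> 0 \<Longrightarrow>
      (norm (p $ 1))\<^sup>2 * exp (- \<alpha> * \<phi> p) + (norm (p $ 2))\<^sup>2 * exp (- \<beta> * \<phi> p) = 1"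
begin

section \<open>The implicit function \<phi>: derivative and smoothness\<close>

definition level :: "complex^2 \<Rightarrow> real \<Rightarrow> real" where
  "level p t = (p $ 1 \<bullet> p $ 1) * exp (- \<alpha> * t) + (p $ 2 \<bullet> p $ 2) * exp (- \<beta> * t)"

text \<open>This is minus the t-derivative of \<open>level p\<close>; its positivity is the
  nondegeneracy needed to solve for \<phi>.\<close>

definition slope :: "complex^2 \<Rightarrow> real \<Rightarrow> real" where
  "slope p t = \<alpha> * (p $ 1 \<bullet> p $ 1) * exp (- \<alpha> * t) + \<beta> * (p $ 2 \<bullet> p $ 2) * exp (- \<beta> * t)"

lemma slope_pos:
  assumes "p \<noteq> 0"
  shows "slope p t > 0"
proof -
  have "p $ 1 \<noteq> 0 \<or> p $ 2 \<noteq> 0"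
    using assms by (auto simp: vec_eq_iff forall_2)
  then have "p $ 1 \<bullet> p $ 1 > 0 \<or> p $ 2 \<bullet> p $ 2 > 0"
    by simp
  then show ?thesis
    using pos unfolding slope_def
    by (elim disjE) (intro add_pos_nonneg add_nonneg_pos mult_pos_pos mult_nonneg_nonneg; simp)+
qed

lemma level_potential: "p \<noteq> 0 \<Longrightarrow> level p (\<phi> p) = 1"
  using potential[of p] by (simp add: level_def power2_norm_eq_inner)

text \<open>Supplies uniqueness: a solution t of \<open>level p t = 1\<close> must be
  \<open>\<phi> p\<close>.\<close>

lemma level_strict_antimono:
  assumes "p \<noteq> 0" "s < t"
  shows "level p t < level p s"
proof (rule DERIV_neg_imp_decreasing[OF assms(2)])
  fix x
  have "(level p has_real_derivative - slope p x) (at x)"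
    unfolding level_def slope_def by (auto intro!: derivative_eq_intros)
  then show "\<exists>y. (level p has_real_derivative y) (at x) \<and> y < 0"
    using slope_pos[OF assms(1)] by fastforce
qed

lemma has_derivative_potential:
  assumes "p \<noteq> 0"
  shows "(\<phi> has_derivative (\<lambda>v. (2 * exp (- \<alpha> * \<phi> p) * (p $ 1 \<bullet> v $ 1)
    + 2 * exp (- \<beta> * \<phi> p) * (p $ 2 \<bullet> v $ 2)) / slope p (\<phi> p))) (at p)"
proof -
  \<comment> \<open>The derivative comes from inverting \<open>(q, t) \<mapsto> (q, level q t)\<close>, which fixes \<open>\<phi>\<close> as
    the second component of the inverse at \<open>(q, 1)\<close>.\<close>
  define S :: "((complex^2) \<times> real) set" where "S = (- {0}) \<times> UNIV"
  define f where "f = (\<lambda>(q, t). (q :: complex^2, level q t))"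
  define g where "g = inv_into S f"
  define L where "L v = 2 * exp (- \<alpha> * \<phi> p) * (p $ 1 \<bullet> v $ 1) + 2 * exp (- \<beta> * \<phi> p) * (p $ 2 \<bullet> v $ 2)"
    for v :: "complex^2"
  define f' where "f' = (\<lambda>(v, s). (v, L v - slope p (\<phi> p) * s))"
  define g' where "g' = (\<lambda>(v, r). (v, (L v - r) / slope p (\<phi> p)))"
  have "open S"
    unfolding S_def by (intro open_Times) auto
  have "inj_on f S"
  proof (rule inj_onI, clarify)
    fix q t q' t' assume "(q, t) \<in> S" and eq: "f (q, t) = f (q', t')"
    then have "q \<noteq> 0" "q' = q" "level q t = level q t'"
      by (auto simp: S_def f_def)
    then show "q = q' \<and> t = t'"
      using level_strict_antimono[of q t t'] level_strict_antimono[of q t' t]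
      by (metis less_irrefl linorder_neqE_linordered_idom)
  qed
  then have gf: "g (f x) = x" if "x \<in> S" for x
    using that by (simp add: g_def)
  have cont: "continuous_on S f"
    unfolding f_def level_def case_prod_beta by (intro continuous_intros)
  have nth: "((\<lambda>x. fst x $ i) has_derivative (\<lambda>x. fst x $ i)) F" for i :: 2 and F ::
      "((complex^2) \<times> real) filter"
    by (rule bounded_linear.has_derivative[OF bounded_linear_vec_nth]) (auto intro: derivative_intros)
  have "(f has_derivative f') (at (p, \<phi> p))"
    unfolding f_def level_def f'_def L_def slope_def case_prod_beta
    by (rule derivative_eq_intros nth refl | simp)+ (auto simp: algebra_simps inner_commute)
  moreover have "f' \<circ> g' = id"
    using slope_pos[OF assms, of "\<phi> p"] by (auto simp: f'_def g'_def fun_eq_iff)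
  \<comment> \<open>This form of the inverse function theorem asks for a continuous injection with
    an invertible derivative at a single point, so no regularity of \<phi> is presupposed.\<close>
  ultimately have "(g has_derivative g') (at (f (p, \<phi> p)))"
    using assms by (intro has_derivative_inverse_strong[OF \<open>open S\<close> _ cont gf]) (auto simp: S_def)
  then have *: "(g has_derivative g') (at (p, 1))"
    using level_potential[OF assms] by (simp add: f_def)
  have deriv: "((\<lambda>q. snd (g (q, 1))) has_derivative (\<lambda>v. snd (g' (v, 0)))) (at p)"
    by (intro has_derivative_snd has_derivative_compose[of "\<lambda>q. (q, 1)" _ p UNIV g g'] *)
      (auto intro!: derivative_eq_intros)
  \<comment> \<open>By the implicit equation, \<open>f\<close> sends \<open>(q, \<phi> q)\<close> to
    \<open>(q, 1)\<close>.\<close>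
  have "snd (g (q, 1)) = \<phi> q" if "q \<in> - {0}" for q
    using gf[of "(q, \<phi> q)"] that level_potential[of q] by (auto simp: f_def S_def)
  then have "(\<phi> has_derivative (\<lambda>v. snd (g' (v, 0)))) (at p)"
    using assms by (intro has_derivative_transform_within_open[OF deriv open_punctured]) auto
  then show ?thesis
    by (simp add: g'_def L_def)
qed

lemma smooth_on_inner_nth: "smooth_on (- {0}) (\<lambda>p :: complex^2. p $ i \<bullet> v)"
  by (intro smooth_on_bounded_linear open_punctured bounded_linear_compose[OF bounded_linear_inner_left]
      bounded_linear_vec_nth)

text \<open>A bootstrap: the derivative of \<phi> is a smooth expression in the point and \<phi>
  itself, so each order of regularity of \<phi> gives the next.\<close>

lemma smooth_on_potential: "smooth_on (- {0}) \<phi>"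
proof -
  have "Ck_on k (- {0}) \<phi>" for k
  proof (induction k)
    case 0
    show ?case
      using has_derivative_potential
      by (auto intro!: continuous_at_imp_continuous_on has_derivative_continuous)
  next
    case (Suc k)
    have inner: "Ck_on k (- {0}) (\<lambda>p :: complex^2. p $ i \<bullet> v)" for i v
      using smooth_on_inner_nth by (simp add: smooth_on_def)
    have inner_self: "Ck_on k (- {0}) (\<lambda>p :: complex^2. p $ i \<bullet> p $ i)" for i
      by (intro Ck_on_bounded_bilinear[OF open_punctured bounded_bilinear_inner]
          Ck_on_bounded_linear open_punctured bounded_linear_vec_nth)
    note intros = Ck_on_mult Ck_on_add Ck_on_exp Ck_on_const open_punctured Suc inner inner_self
    have "Ck_on k (- {0}) (\<lambda>p. (2 * exp (- \<alpha> * \<phi> p) * (p $ 1 \<bullet> v $ 1)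
        + 2 * exp (- \<beta> * \<phi> p) * (p $ 2 \<bullet> v $ 2)) / slope p (\<phi> p))" for v
    proof -
      have "Ck_on k (- {0}) (\<lambda>p. inverse (slope p (\<phi> p)))"
      proof (rule Ck_on_inverse[OF open_punctured])
        show "Ck_on k (- {0}) (\<lambda>p. slope p (\<phi> p))"
          unfolding slope_def by (intro intros)
        show "slope p (\<phi> p) \<noteq> 0" if "p \<in> - {0}" for p
          using slope_pos[of p "\<phi> p"] that by simp
      qed
      then show ?thesis
        unfolding divide_inverse by (intro intros)
    qed
    then show ?case
      by (intro Ck_on_SucI[OF open_punctured has_derivative_potential]) auto
  qed
  then show ?thesis
    by (simp add: smooth_on_def)
qed

section \<open>Complex-valued ingredients of the metric and their first derivatives\<close>

definition E :: "complex^2 \<Rightarrow> complex" where "E p = exp (- of_real \<alpha> * of_real (\<phi> p))"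
definition F :: "complex^2 \<Rightarrow> complex" where "F p = exp (- of_real \<beta> * of_real (\<phi> p))"
definition u :: "complex^2 \<Rightarrow> complex" where "u p = p $ 1 * cnj (p $ 1) * E p"
definition v :: "complex^2 \<Rightarrow> complex" where "v p = p $ 2 * cnj (p $ 2) * F p"
text \<open>\<open>D\<close> is the paper's $\Delta$, and so is \<open>slope p (\<phi> p)\<close>.\<close>

definition D :: "complex^2 \<Rightarrow> complex" where "D p = of_real \<alpha> * u p + of_real \<beta> * v p"

lemma E_eq_of_real: "E p = of_real (exp (- \<alpha> * \<phi> p))"
  by (simp add: E_def exp_of_real flip: of_real_mult of_real_minus)

lemma F_eq_of_real: "F p = of_real (exp (- \<beta> * \<phi> p))"
  by (simp add: F_def exp_of_real flip: of_real_mult of_real_minus)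

lemma cnj_E [simp]: "cnj (E p) = E p"
  by (simp add: E_eq_of_real)

lemma cnj_F [simp]: "cnj (F p) = F p"
  by (simp add: F_eq_of_real)

lemma cnj_u [simp]: "cnj (u p) = u p"
  by (simp add: u_def)

lemma cnj_v [simp]: "cnj (v p) = v p"
  by (simp add: v_def)

lemma cnj_D [simp]: "cnj (D p) = D p"
  by (simp add: D_def)

lemma E_nonzero [simp]: "E p \<noteq> 0" and F_nonzero [simp]: "F p \<noteq> 0"
  by (simp_all add: E_def F_def)

lemma u_eq_of_real: "u p = of_real ((p $ 1 \<bullet> p $ 1) * exp (- \<alpha> * \<phi> p))"
  by (simp add: u_def E_eq_of_real complex_mult_cnj inner_complex_def power2_eq_square)

lemma v_eq_of_real: "v p = of_real ((p $ 2 \<bullet> p $ 2) * exp (- \<beta> * \<phi> p))"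
  by (simp add: v_def F_eq_of_real complex_mult_cnj inner_complex_def power2_eq_square)

lemma D_eq_slope: "D p = of_real (slope p (\<phi> p))"
  by (simp add: D_def u_eq_of_real v_eq_of_real slope_def)

lemma D_nonzero: "p \<noteq> 0 \<Longrightarrow> D p \<noteq> 0"
  using slope_pos[of p "\<phi> p"] by (simp add: D_eq_slope)

lemma u_add_v: "p \<noteq> 0 \<Longrightarrow> u p + v p = 1"
  unfolding u_eq_of_real v_eq_of_real of_real_add[symmetric]
  using level_potential[of p] by (simp add: level_def del: of_real_add of_real_mult)

lemma sum_eq_2_complex: "complex_of_real \<alpha> + complex_of_real \<beta> = 2"
  using sum_eq_2 by (simp flip: of_real_add)

lemma has_wirtinger_potential:
  assumes "p \<noteq> 0"
  shows "has_wirtinger (\<lambda>q. of_real (\<phi> q))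
    (cnj (p $ 1) * E p / D p) (cnj (p $ 2) * F p / D p) (p $ 1 * E p / D p) (p $ 2 * F p / D p) p"
proof -
  \<comment> \<open>The real inner product on the complex numbers is Re (cnj a * b); twice it splits
    into a dz part and its conjugate.\<close>
  have "of_real (2 * x * (a \<bullet> b)) = cnj a * of_real x * b + a * of_real x * cnj b" for a b ::
      complex and x
    by (simp add: complex_eq_iff inner_complex_def algebra_simps)
  then show ?thesis
    unfolding has_wirtinger_def E_eq_of_real F_eq_of_real D_eq_slope
    by (intro has_derivative_eq_rhs[OF has_derivative_of_real[OF has_derivative_potential[OF assms]]]
        ext)
      (simp only: of_real_divide of_real_add, simp add: add_divide_distrib)
qed

lemma has_wirtinger_E:
  assumes "p \<noteq> 0"
  shows "has_wirtinger E
    (- \<alpha> * E p * (cnj (p $ 1) * E p) / D p) (- \<alpha> * E p * (cnj (p $ 2) * F p) / D p)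
    (- \<alpha> * E p * (p $ 1 * E p) / D p) (- \<alpha> * E p * (p $ 2 * F p) / D p) p"
  unfolding E_def[abs_def]
  by (rule has_wirtinger_eq_rhs[OF has_wirtinger_exp[OF
        has_wirtinger_mult[OF has_wirtinger_const has_wirtinger_potential[OF assms]]]])
    (simp_all add: E_def)

lemma has_wirtinger_F:
  assumes "p \<noteq> 0"
  shows "has_wirtinger F
    (- \<beta> * F p * (cnj (p $ 1) * E p) / D p) (- \<beta> * F p * (cnj (p $ 2) * F p) / D p)
    (- \<beta> * F p * (p $ 1 * E p) / D p) (- \<beta> * F p * (p $ 2 * F p) / D p) p"
  unfolding F_def[abs_def]
  by (rule has_wirtinger_eq_rhs[OF has_wirtinger_exp[OF
        has_wirtinger_mult[OF has_wirtinger_const has_wirtinger_potential[OF assms]]]])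
    (simp_all add: F_def)

text \<open>The product rule gives the factor 1 - \<alpha> u / D in the first slot, and D = \<alpha>
  u + \<beta> v turns it into \<beta> v / D. In this shape the derivatives of \<open>u\<close> and
  \<open>v\<close> are visibly opposite, matching u + v = 1.\<close>

lemma has_wirtinger_u:
  assumes "p \<noteq> 0"
  shows "has_wirtinger u
    (\<beta> * v p * (cnj (p $ 1) * E p) / D p) (- \<alpha> * u p * (cnj (p $ 2) * F p) / D p)
    (\<beta> * v p * (p $ 1 * E p) / D p) (- \<alpha> * u p * (p $ 2 * F p) / D p) p"
proof -
  have D: "D p \<noteq> 0" "\<beta> * v p = D p - \<alpha> * u p"
    using D_nonzero[OF assms] by (simp_all add: D_def)
  show ?thesis
    unfolding u_def[abs_def]
    by (rule has_wirtinger_eq_rhs[OF has_wirtinger_mult[OF has_wirtinger_mult[OF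
          has_wirtinger_nth(1) has_wirtinger_cnj[OF has_wirtinger_nth(1)]] has_wirtinger_E[OF assms]]])
      (simp_all only: u_def[symmetric] D(2),
        use D(1) in \<open>simp_all add: u_def field_simps\<close>)
qed

lemma has_wirtinger_v:
  assumes "p \<noteq> 0"
  shows "has_wirtinger v
    (- \<beta> * v p * (cnj (p $ 1) * E p) / D p) (\<alpha> * u p * (cnj (p $ 2) * F p) / D p)
    (- \<beta> * v p * (p $ 1 * E p) / D p) (\<alpha> * u p * (p $ 2 * F p) / D p) p"
proof -
  have D: "D p \<noteq> 0" "\<alpha> * u p = D p - \<beta> * v p"
    using D_nonzero[OF assms] by (simp_all add: D_def)
  show ?thesis
    unfolding v_def[abs_def]
    by (rule has_wirtinger_eq_rhs[OF has_wirtinger_mult[OF has_wirtinger_mult[OF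
          has_wirtinger_nth(2) has_wirtinger_cnj[OF has_wirtinger_nth(2)]] has_wirtinger_F[OF assms]]])
      (simp_all only: v_def[symmetric] D(2),
        use D(1) in \<open>simp_all add: v_def field_simps\<close>)
qed

text \<open>Since dv = -du, the differential of D is (\<alpha> - \<beta>) du.\<close>

lemma has_wirtinger_D:
  assumes "p \<noteq> 0"
  shows "has_wirtinger D
    ((\<alpha> - \<beta>) * (\<beta> * v p * (cnj (p $ 1) * E p) / D p)) ((\<alpha> - \<beta>) * (-
        \<alpha> * u p * (cnj (p $ 2) * F p) / D p))
    ((\<alpha> - \<beta>) * (\<beta> * v p * (p $ 1 * E p) / D p)) ((\<alpha> - \<beta>) * (- \<alpha> * u p * (p $ 2 * F p) / D p)) p"
  unfolding D_def[abs_def]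
  by (rule has_wirtinger_eq_rhs[OF has_wirtinger_add[OF
        has_wirtinger_mult[OF has_wirtinger_const has_wirtinger_u[OF assms]]
        has_wirtinger_mult[OF has_wirtinger_const has_wirtinger_v[OF assms]]]])
    (simp_all add: D_def[symmetric] D_nonzero[OF assms] field_simps)

section \<open>The complex Hessian of \<phi> and the metric in closed form\<close>

lemma normal_forms:
  assumes "p \<noteq> 0"
  shows "D p = \<alpha> * (p $ 1 * cnj (p $ 1) * E p) + \<beta> * (p $ 2 * cnj (p $ 2) * F p)"
    "p $ 1 * cnj (p $ 1) * E p + p $ 2 * cnj (p $ 2) * F p = 1"
  using u_add_v[OF assms] by (simp_all add: D_def u_def v_def)

text \<open>The function is the zbar^1-derivative of \<phi>, so the first two slots are entries of
  its complex Hessian, of the rank-one shape E F eta_i cnj(eta_j) / D^3. With denominators cleared,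
  the claims are polynomial identities modulo the relations in \<open>normal_forms\<close>.\<close>

lemma has_wirtinger_dzbar_potential_1:
  assumes "p \<noteq> 0"
  shows "has_wirtinger (\<lambda>q. q $ 1 * E q / D q)
    (\<beta>\<^sup>2 * E p * v p / D p ^ 3) (- \<alpha> * \<beta> * p $ 1 * cnj (p $ 2) * E p * F p / D p ^ 3)
    (- (p $ 1 * E p)\<^sup>2 * (\<alpha> * D p + (\<alpha> - \<beta>) * \<beta> * v p) / D p ^ 3)
    (- \<alpha> * \<beta> * (p $ 1 * E p) * (p $ 2 * F p) / D p ^ 3) p"
  by (rule has_wirtinger_eq_rhs[OF has_wirtinger_divide[OF has_wirtinger_mult[OF
        has_wirtinger_nth(1) has_wirtinger_E[OF assms]] has_wirtinger_D[OF assms] D_nonzero[OF assms]]])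
    (simp_all add: D_nonzero[OF assms] u_def v_def divide_simps power2_eq_square power3_eq_cube,
      insert normal_forms[OF assms], (algebra | simp add: algebra_simps)+)

lemma has_wirtinger_dzbar_potential_2:
  assumes "p \<noteq> 0"
  shows "has_wirtinger (\<lambda>q. q $ 2 * F q / D q)
    (- \<alpha> * \<beta> * cnj (p $ 1) * p $ 2 * E p * F p / D p ^ 3) (\<alpha>\<^sup>2 * F p * u p / D p ^ 3)
    (- \<alpha> * \<beta> * (p $ 1 * E p) * (p $ 2 * F p) / D p ^ 3)
    (- (p $ 2 * F p)\<^sup>2 * (\<beta> * D p + (\<beta> - \<alpha>) * \<alpha> * u p) / D p ^ 3) p"
  by (rule has_wirtinger_eq_rhs[OF has_wirtinger_divide[OF has_wirtinger_mult[OF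
        has_wirtinger_nth(2) has_wirtinger_F[OF assms]] has_wirtinger_D[OF assms] D_nonzero[OF assms]]])
    (simp_all add: D_nonzero[OF assms] u_def v_def divide_simps power2_eq_square power3_eq_cube,
      insert normal_forms[OF assms], (algebra | simp add: algebra_simps)+)

lemma ddbar_potential:
  assumes "p \<noteq> 0"
  shows "ddbar (\<lambda>q. of_real (\<phi> q)) p $ 1 $ 1 = \<beta>\<^sup>2 * E p * v p / D p ^ 3"
    "ddbar (\<lambda>q. of_real (\<phi> q)) p $ 1 $ 2 = - \<alpha> * \<beta> * cnj (p $ 1) * p $ 2 * E p * F p / D p ^ 3"
    "ddbar (\<lambda>q. of_real (\<phi> q)) p $ 2 $ 1 = - \<alpha> * \<beta> * p $ 1 * cnj (p $ 2) * E p * F p / D p ^ 3"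
    "ddbar (\<lambda>q. of_real (\<phi> q)) p $ 2 $ 2 = \<alpha>\<^sup>2 * F p * u p / D p ^ 3"
proof -
  have p: "p \<in> - {0}"
    using assms by simp
  \<comment> \<open>The first derivatives are identified on the whole punctured space, not just at
    \<open>p\<close>, so that they may be differentiated again.\<close>
  have 1: "q $ 1 * E q / D q = dzbar 1 (\<lambda>q. of_real (\<phi> q)) q"
    and 2: "q $ 2 * F q / D q = dzbar 2 (\<lambda>q. of_real (\<phi> q)) q" if "q \<in> - {0}" for q
    using has_wirtinger_imp_dz[OF has_wirtinger_potential[of q]] that by simp_all
  note * =
    has_wirtinger_transform_within_open[OF has_wirtinger_dzbar_potential_1[OF assms] open_punctured p 1]
    has_wirtinger_transform_within_open[OF has_wirtinger_dzbar_potential_2[OF assms] open_punctured p 2]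
  show "ddbar (\<lambda>q. of_real (\<phi> q)) p $ 1 $ 1 = \<beta>\<^sup>2 * E p * v p / D p ^ 3"
    "ddbar (\<lambda>q. of_real (\<phi> q)) p $ 1 $ 2 = - \<alpha> * \<beta> * cnj (p $ 1) * p $ 2 * E p * F p / D p ^ 3"
    "ddbar (\<lambda>q. of_real (\<phi> q)) p $ 2 $ 1 = - \<alpha> * \<beta> * p $ 1 * cnj (p $ 2) * E p * F p / D p ^ 3"
    "ddbar (\<lambda>q. of_real (\<phi> q)) p $ 2 $ 2 = \<alpha>\<^sup>2 * F p * u p / D p ^ 3"
    using *[THEN has_wirtinger_imp_dz(1)] *[THEN has_wirtinger_imp_dz(2)] by (simp_all add: ddbar_def)
qed

text \<open>Dividing by Phi = exp \<phi> and subtracting half the Hessian of \<phi> leaves \<phi>_i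
  \<phi>_jbar + (1/2) \<phi>_{i jbar}, the bracket in the metric.\<close>

lemma ddbar_exp_potential:
  assumes "p \<noteq> 0"
  shows "ddbar (\<lambda>q. of_real (exp (\<phi> q))) p $ i $ j = of_real (exp (\<phi> p)) *
    (dz i (\<lambda>q. of_real (\<phi> q)) p * dzbar j (\<lambda>q. of_real (\<phi> q)) p + ddbar (\<lambda>q. of_real (\<phi> q)) p $ i $ j)"
proof -
  have p: "p \<in> - {0}"
    using assms by simp
  note exp = has_wirtinger_exp[OF has_wirtinger_potential]
  have 1: "exp (of_real (\<phi> q)) * (q $ 1 * E q / D q) = dzbar 1 (\<lambda>q. of_real (exp (\<phi> q))) q"
    and 2: "exp (of_real (\<phi> q)) * (q $ 2 * F q / D q) = dzbar 2 (\<lambda>q. of_real (exp (\<phi> q))) q"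
    if "q \<in> - {0}" for q
    using has_wirtinger_imp_dz[OF exp[of q]] that by (simp_all flip: exp_of_real)
  note * =
    has_wirtinger_transform_within_open[OF has_wirtinger_mult[OF exp[OF assms]
      has_wirtinger_dzbar_potential_1[OF assms]] open_punctured p 1]
    has_wirtinger_transform_within_open[OF has_wirtinger_mult[OF exp[OF assms]
      has_wirtinger_dzbar_potential_2[OF assms]] open_punctured p 2]
  have "i = 1 \<or> i = 2" "j = 1 \<or> j = 2"
    using exhaust_2 by auto
  then show ?thesis
    using *[THEN has_wirtinger_imp_dz(1)] *[THEN has_wirtinger_imp_dz(2)]
    by (elim disjE) (simp_all add: ddbar_potential[OF assms]
        has_wirtinger_imp_dz[OF has_wirtinger_potential[OF assms]],
        simp_all add: ddbar_def exp_of_real algebra_simps)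
qed

text \<open>The entries of (1/2) E F eta_i cnj(eta_j) + D xi_i cnj(xi_j), with |z|^2 E and |w|^2 F
  on the diagonal rewritten as \<open>u\<close> and \<open>v\<close>. No division by
  \<open>D\<close> remains.\<close>

definition metric :: "complex^2 \<Rightarrow> complex^2^2" where
  "metric p = vector
    [vector [E p * (D p * u p + \<beta>\<^sup>2 / 2 * v p), cnj (p $ 1) * p $ 2 * E p * F p * (D p - \<alpha> * \<beta> / 2)],
     vector [p $ 1 * cnj (p $ 2) * E p * F p * (D p - \<alpha> * \<beta> / 2), F p * (D p * v p + \<alpha>\<^sup>2 / 2 * u p)]]"

lemma metric_nth:
  "metric p $ 1 $ 1 = E p * (D p * u p + \<beta>\<^sup>2 / 2 * v p)"
  "metric p $ 1 $ 2 = cnj (p $ 1) * p $ 2 * E p * F p * (D p - \<alpha> * \<beta> / 2)"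
  "metric p $ 2 $ 1 = p $ 1 * cnj (p $ 2) * E p * F p * (D p - \<alpha> * \<beta> / 2)"
  "metric p $ 2 $ 2 = F p * (D p * v p + \<alpha>\<^sup>2 / 2 * u p)"
  by (simp_all add: metric_def)

lemma metric_eq_ddbar:
  assumes "p \<noteq> 0"
  shows "D p ^ 3 * (1 / of_real (exp (\<phi> p)) * ddbar (\<lambda>q. of_real (exp (\<phi> q))) p $ i $ j
    - 1 / 2 * ddbar (\<lambda>q. of_real (\<phi> q)) p $ i $ j) = metric p $ i $ j"
proof -
  have "i = 1 \<or> i = 2" "j = 1 \<or> j = 2"
    using exhaust_2 by auto
  then show ?thesis
    unfolding ddbar_exp_potential[OF assms]
    by (elim disjE) (simp_all add: ddbar_potential[OF assms] metric_nth
        has_wirtinger_imp_dz[OF has_wirtinger_potential[OF assms]],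
        simp_all add: D_nonzero[OF assms] divide_simps power2_eq_square power3_eq_cube u_def v_def,
        simp_all add: algebra_simps)
qed

section \<open>Derivatives of log det and of the metric coefficients\<close>

text \<open>These are $\frac12\partial_{\bar j}\log\det h$, and \<open>chi\<close> is the factor by which
  their $\partial_i$-derivatives differ from $\varphi_{i\bar j}$.\<close>

definition half_dlogdet_1 :: "complex^2 \<Rightarrow> complex" where
  "half_dlogdet_1 p = p $ 1 * E p / D p * (3 / 2 * (\<alpha> - \<beta>) * \<beta> * v p / D p - 1)"

definition half_dlogdet_2 :: "complex^2 \<Rightarrow> complex" where
  "half_dlogdet_2 p = p $ 2 * F p / D p * (- 3 / 2 * (\<alpha> - \<beta>) * \<alpha> * u p / D p - 1)"

definition chi :: "complex^2 \<Rightarrow> complex" where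
  "chi p = - 1 - 3 / 2 * (\<alpha> - \<beta>) * (\<alpha> * u p - \<beta> * v p) / D p"

text \<open>The mixed derivatives are the real factor \<open>chi\<close> times the Hessian of
  \<phi>, a Hermitian matrix; this symmetry is what later cancels the Ricci form. The existential
  barred slots are filled by unification.\<close>

lemma has_wirtinger_half_dlogdet_1:
  assumes "p \<noteq> 0"
  shows "\<exists>b1 b2. has_wirtinger half_dlogdet_1
    (chi p * (\<beta>\<^sup>2 * E p * v p / D p ^ 3))
    (chi p * (- \<alpha> * \<beta> * p $ 1 * cnj (p $ 2) * E p * F p / D p ^ 3)) b1 b2 p"
  unfolding half_dlogdet_1_def[abs_def]
  by (intro exI, rule has_wirtinger_eq_rhs[OF has_wirtinger_mult[OF
      has_wirtinger_dzbar_potential_1[OF assms]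
        has_wirtinger_diff[OF has_wirtinger_divide[OF has_wirtinger_mult[OF has_wirtinger_const
        has_wirtinger_v[OF assms]] has_wirtinger_D[OF assms] D_nonzero[OF assms]]
            has_wirtinger_const]]])
    (simp_all add: D_nonzero[OF assms] chi_def,
      simp_all add: D_nonzero[OF assms] divide_simps power2_eq_square power3_eq_cube,
      insert u_def[of p] v_def[of p] u_add_v[OF assms] D_def[of p], algebra+)

lemma has_wirtinger_half_dlogdet_2:
  assumes "p \<noteq> 0"
  shows "\<exists>b1 b2. has_wirtinger half_dlogdet_2
    (chi p * (- \<alpha> * \<beta> * cnj (p $ 1) * p $ 2 * E p * F p / D p ^ 3))
    (chi p * (\<alpha>\<^sup>2 * F p * u p / D p ^ 3)) b1 b2 p"
  unfolding half_dlogdet_2_def[abs_def]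
  by (intro exI, rule has_wirtinger_eq_rhs[OF has_wirtinger_mult[OF
      has_wirtinger_dzbar_potential_2[OF assms]
        has_wirtinger_diff[OF has_wirtinger_divide[OF has_wirtinger_mult[OF has_wirtinger_const
        has_wirtinger_u[OF assms]] has_wirtinger_D[OF assms] D_nonzero[OF assms]]
            has_wirtinger_const]]])
    (simp_all add: D_nonzero[OF assms] chi_def,
      simp_all add: D_nonzero[OF assms] divide_simps power2_eq_square power3_eq_cube,
      insert u_def[of p] v_def[of p] u_add_v[OF assms] D_def[of p], algebra+)

text \<open>With dD = (\<alpha> - \<beta>) du and dv = -du, the bracket D u + \<beta>^2 v / 2 has
  differential ((\<alpha> - \<beta>) u + D - \<beta>^2 / 2) du; the remaining summand comes from dE
  = -\<alpha> E d\<phi>.\<close>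

lemma has_wirtinger_metric_11:
  assumes "p \<noteq> 0"
  shows "has_wirtinger (\<lambda>q. metric q $ 1 $ 1)
    (E p * (cnj (p $ 1) * E p) / D p * (((\<alpha> - \<beta>) * u p + D p - \<beta>\<^sup>2 / 2) *
        \<beta> * v p - \<alpha> * (D p * u p + \<beta>\<^sup>2 / 2 * v p)))
    (E p * (cnj (p $ 2) * F p) / D p * (- ((\<alpha> - \<beta>) * u p + D p - \<beta>\<^sup>2 / 2) *
        \<alpha> * u p - \<alpha> * (D p * u p + \<beta>\<^sup>2 / 2 * v p)))
    (E p * (p $ 1 * E p) / D p * (((\<alpha> - \<beta>) * u p + D p - \<beta>\<^sup>2 / 2) * \<beta>
        * v p - \<alpha> * (D p * u p + \<beta>\<^sup>2 / 2 * v p)))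
    (E p * (p $ 2 * F p) / D p * (- ((\<alpha> - \<beta>) * u p + D p - \<beta>\<^sup>2 / 2) *
        \<alpha> * u p - \<alpha> * (D p * u p + \<beta>\<^sup>2 / 2 * v p))) p"
  unfolding metric_nth
  by (rule has_wirtinger_eq_rhs[OF has_wirtinger_mult[OF has_wirtinger_E[OF assms]
      has_wirtinger_add[OF has_wirtinger_mult[OF has_wirtinger_D[OF assms] has_wirtinger_u[OF assms]]
      has_wirtinger_mult[OF has_wirtinger_const has_wirtinger_v[OF assms]]]]])
    (simp_all add: D_nonzero[OF assms] divide_simps power2_eq_square,
      insert u_def[of p] v_def[of p] sum_eq_2_complex, (algebra | simp add: algebra_simps)+)

lemma has_wirtinger_metric_22:
  assumes "p \<noteq> 0"
  shows "has_wirtinger (\<lambda>q. metric q $ 2 $ 2)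
    (F p * (cnj (p $ 1) * E p) / D p * (((\<alpha> - \<beta>) * v p - D p + \<alpha>\<^sup>2 / 2) *
        \<beta> * v p - \<beta> * (D p * v p + \<alpha>\<^sup>2 / 2 * u p)))
    (F p * (cnj (p $ 2) * F p) / D p * (- ((\<alpha> - \<beta>) * v p - D p + \<alpha>\<^sup>2 / 2) *
        \<alpha> * u p - \<beta> * (D p * v p + \<alpha>\<^sup>2 / 2 * u p)))
    (F p * (p $ 1 * E p) / D p * (((\<alpha> - \<beta>) * v p - D p + \<alpha>\<^sup>2 / 2) * \<beta>
        * v p - \<beta> * (D p * v p + \<alpha>\<^sup>2 / 2 * u p)))
    (F p * (p $ 2 * F p) / D p * (- ((\<alpha> - \<beta>) * v p - D p + \<alpha>\<^sup>2 / 2) *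
        \<alpha> * u p - \<beta> * (D p * v p + \<alpha>\<^sup>2 / 2 * u p))) p"
  unfolding metric_nth
  by (rule has_wirtinger_eq_rhs[OF has_wirtinger_mult[OF has_wirtinger_F[OF assms]
      has_wirtinger_add[OF has_wirtinger_mult[OF has_wirtinger_D[OF assms] has_wirtinger_v[OF assms]]
      has_wirtinger_mult[OF has_wirtinger_const has_wirtinger_u[OF assms]]]]])
    (simp_all add: D_nonzero[OF assms] divide_simps power2_eq_square,
      insert u_def[of p] v_def[of p] sum_eq_2_complex, (algebra | simp add: algebra_simps)+)

text \<open>The coefficient 2 is \<alpha> + \<beta>: E F = exp (-2 \<phi>), so differentiating this
  product contributes -2 d\<phi>.\<close>

lemma has_wirtinger_metric_12:
  assumes "p \<noteq> 0"
  shows "has_wirtinger (\<lambda>q. metric q $ 1 $ 2)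
    (cnj (p $ 1) * p $ 2 * E p * F p * (cnj (p $ 1) * E p) / D p * ((\<alpha> - \<beta>) * \<beta> *
        v p - 2 * (D p - \<alpha> * \<beta> / 2)))
    (cnj (p $ 1) * E p * F p * ((D p - \<alpha> * \<beta> / 2) + v p / D p * (- (\<alpha> - \<beta>)
        * \<alpha> * u p - 2 * (D p - \<alpha> * \<beta> / 2))))
    (p $ 2 * E p * F p * ((D p - \<alpha> * \<beta> / 2) + u p / D p * ((\<alpha> - \<beta>) * \<beta> * v p - 2 * (D p - \<alpha> * \<beta> / 2))))
    (cnj (p $ 1) * p $ 2 * E p * F p * (p $ 2 * F p) / D p * (- (\<alpha> - \<beta>) * \<alpha> * u p
        - 2 * (D p - \<alpha> * \<beta> / 2))) p"
  unfolding metric_nth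
  by (rule has_wirtinger_eq_rhs[OF has_wirtinger_mult[OF has_wirtinger_mult[OF has_wirtinger_mult[OF
      has_wirtinger_mult[OF has_wirtinger_cnj[OF has_wirtinger_nth(1)] has_wirtinger_nth(2)]
      has_wirtinger_E[OF assms]] has_wirtinger_F[OF assms]] has_wirtinger_diff[OF has_wirtinger_D[OF
      assms] has_wirtinger_const]]])
    (simp_all add: D_nonzero[OF assms] divide_simps power2_eq_square,
      insert u_def[of p] v_def[of p] sum_eq_2_complex, (algebra | simp add: algebra_simps)+)

lemma has_wirtinger_metric_21:
  assumes "p \<noteq> 0"
  shows "has_wirtinger (\<lambda>q. metric q $ 2 $ 1)
    (cnj (p $ 2) * E p * F p * ((D p - \<alpha> * \<beta> / 2) + u p / D p * ((\<alpha> - \<beta>) *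
        \<beta> * v p - 2 * (D p - \<alpha> * \<beta> / 2))))
    (p $ 1 * cnj (p $ 2) * E p * F p * (cnj (p $ 2) * F p) / D p * (- (\<alpha> - \<beta>) * \<alpha>
        * u p - 2 * (D p - \<alpha> * \<beta> / 2)))
    (p $ 1 * cnj (p $ 2) * E p * F p * (p $ 1 * E p) / D p * ((\<alpha> - \<beta>) * \<beta> * v p -
        2 * (D p - \<alpha> * \<beta> / 2)))
    (p $ 1 * E p * F p * ((D p - \<alpha> * \<beta> / 2) + v p / D p * (- (\<alpha> - \<beta>) *
        \<alpha> * u p - 2 * (D p - \<alpha> * \<beta> / 2)))) p"
  unfolding metric_nth
  by (rule has_wirtinger_eq_rhs[OF has_wirtinger_mult[OF has_wirtinger_mult[OF has_wirtinger_mult[OF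
      has_wirtinger_mult[OF has_wirtinger_nth(1) has_wirtinger_cnj[OF has_wirtinger_nth(2)]]
      has_wirtinger_E[OF assms]] has_wirtinger_F[OF assms]] has_wirtinger_diff[OF has_wirtinger_D[OF
      assms] has_wirtinger_const]]])
    (simp_all add: D_nonzero[OF assms] divide_simps power2_eq_square,
      insert u_def[of p] v_def[of p] sum_eq_2_complex, (algebra | simp add: algebra_simps)+)

subsection \<open>Ricci-flatness\<close>

definition det_metric :: "complex^2 \<Rightarrow> complex" where
  "det_metric p = E p * F p * D p ^ 3 / 2"

text \<open>For a sum of two rank-one forms the determinant is (1/2) E F * D * |eta_1 xi_2 - eta_2
  xi_1|^2, and eta_1 xi_2 - eta_2 xi_1 = \<alpha> u + \<beta> v = D.\<close>

lemma det_metric: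
  assumes "p \<noteq> 0"
  shows "metric p $ 1 $ 1 * metric p $ 2 $ 2 - metric p $ 1 $ 2 * metric p $ 2 $ 1 = det_metric p"
  unfolding metric_nth det_metric_def
  by (simp add: field_simps power2_eq_square power3_eq_cube,
      insert u_def[of p] v_def[of p] u_add_v[OF assms] D_def[of p] sum_eq_2_complex, algebra)

lemma det_metric_nonzero: "p \<noteq> 0 \<Longrightarrow> det_metric p \<noteq> 0"
  by (simp add: det_metric_def D_nonzero)

lemmas has_wirtinger_metric =
  has_wirtinger_metric_11 has_wirtinger_metric_12 has_wirtinger_metric_21 has_wirtinger_metric_22

lemmas metric_derivs = has_wirtinger_metric[THEN has_wirtinger_imp_dz(1)]
  has_wirtinger_metric[THEN has_wirtinger_imp_dz(2)]
  has_wirtinger_metric[THEN has_wirtinger_imp_dz(3)]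
  has_wirtinger_metric[THEN has_wirtinger_imp_dz(4)]

text \<open>The left side is the determinant times h^{k lbar} d_k h_{1 lbar}, with the inverse
  written by cofactors. Scaling a metric by exp f adds d_i f to this contraction; the factor D^3
  adds exactly the 3 d_i log D that cancels the rest.\<close>

lemma contraction_1:
  assumes "p \<noteq> 0"
  shows "metric p $ 2 $ 2 * dz 1 (\<lambda>q. metric q $ 1 $ 1) p
    - metric p $ 2 $ 1 * dz 1 (\<lambda>q. metric q $ 1 $ 2) p
    - metric p $ 1 $ 2 * dz 2 (\<lambda>q. metric q $ 1 $ 1) p
    + metric p $ 1 $ 1 * dz 2 (\<lambda>q. metric q $ 1 $ 2) p = 0"
  unfolding metric_derivs[OF assms] unfolding metric_nth
  by (simp add: D_nonzero[OF assms] divide_simps power2_eq_square power3_eq_cube,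
      insert u_def[of p] v_def[of p] u_add_v[OF assms] D_def[of p] sum_eq_2_complex, algebra)

text \<open>Jacobi's formula: the left side is the z^1-derivative of the determinant. The conjugate
  appears because \<open>half_dlogdet_1\<close> is a barred derivative and the determinant is
  real.\<close>

lemma det_deriv_1:
  assumes "p \<noteq> 0"
  shows "metric p $ 2 $ 2 * dz 1 (\<lambda>q. metric q $ 1 $ 1) p
    - metric p $ 2 $ 1 * dz 1 (\<lambda>q. metric q $ 1 $ 2) p
    - metric p $ 1 $ 2 * dz 1 (\<lambda>q. metric q $ 2 $ 1) p
    + metric p $ 1 $ 1 * dz 1 (\<lambda>q. metric q $ 2 $ 2) p = 2 * det_metric p * cnj (half_dlogdet_1 p)"
  unfolding metric_derivs[OF assms] unfolding metric_nth half_dlogdet_1_def det_metric_def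
  by (simp add: D_nonzero[OF assms] divide_simps power2_eq_square power3_eq_cube,
      insert u_def[of p] v_def[of p] u_add_v[OF assms] D_def[of p] sum_eq_2_complex, algebra)

text \<open>The conjugate counterpart, for h^{k lbar} d_lbar h_{k 1bar}: the term that
  \<open>lc_Gamma_bar\<close> subtracts in its trace.\<close>

lemma contraction_bar_1:
  assumes "p \<noteq> 0"
  shows "metric p $ 2 $ 2 * dzbar 1 (\<lambda>q. metric q $ 1 $ 1) p
    - metric p $ 1 $ 2 * dzbar 1 (\<lambda>q. metric q $ 2 $ 1) p
    - metric p $ 2 $ 1 * dzbar 2 (\<lambda>q. metric q $ 1 $ 1) p
    + metric p $ 1 $ 1 * dzbar 2 (\<lambda>q. metric q $ 2 $ 1) p = 0"
  unfolding metric_derivs[OF assms] unfolding metric_nth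
  by (simp add: D_nonzero[OF assms] divide_simps power2_eq_square power3_eq_cube,
      insert u_def[of p] v_def[of p] u_add_v[OF assms] D_def[of p] sum_eq_2_complex, algebra)

lemma det_deriv_bar_1:
  assumes "p \<noteq> 0"
  shows "metric p $ 2 $ 2 * dzbar 1 (\<lambda>q. metric q $ 1 $ 1) p
    - metric p $ 2 $ 1 * dzbar 1 (\<lambda>q. metric q $ 1 $ 2) p
    - metric p $ 1 $ 2 * dzbar 1 (\<lambda>q. metric q $ 2 $ 1) p
    + metric p $ 1 $ 1 * dzbar 1 (\<lambda>q. metric q $ 2 $ 2) p = 2 * det_metric p * half_dlogdet_1 p"
  unfolding metric_derivs[OF assms] unfolding metric_nth half_dlogdet_1_def det_metric_def
  by (simp add: D_nonzero[OF assms] divide_simps power2_eq_square power3_eq_cube,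
      insert u_def[of p] v_def[of p] u_add_v[OF assms] D_def[of p] sum_eq_2_complex, algebra)

lemma contraction_2:
  assumes "p \<noteq> 0"
  shows "metric p $ 2 $ 2 * dz 1 (\<lambda>q. metric q $ 2 $ 1) p
    - metric p $ 2 $ 1 * dz 1 (\<lambda>q. metric q $ 2 $ 2) p
    - metric p $ 1 $ 2 * dz 2 (\<lambda>q. metric q $ 2 $ 1) p
    + metric p $ 1 $ 1 * dz 2 (\<lambda>q. metric q $ 2 $ 2) p = 0"
  unfolding metric_derivs[OF assms] unfolding metric_nth
  by (simp add: D_nonzero[OF assms] divide_simps power2_eq_square power3_eq_cube,
      insert u_def[of p] v_def[of p] u_add_v[OF assms] D_def[of p] sum_eq_2_complex, algebra)

lemma det_deriv_2:
  assumes "p \<noteq> 0"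
  shows "metric p $ 2 $ 2 * dz 2 (\<lambda>q. metric q $ 1 $ 1) p
    - metric p $ 2 $ 1 * dz 2 (\<lambda>q. metric q $ 1 $ 2) p
    - metric p $ 1 $ 2 * dz 2 (\<lambda>q. metric q $ 2 $ 1) p
    + metric p $ 1 $ 1 * dz 2 (\<lambda>q. metric q $ 2 $ 2) p = 2 * det_metric p * cnj (half_dlogdet_2 p)"
  unfolding metric_derivs[OF assms] unfolding metric_nth half_dlogdet_2_def det_metric_def
  by (simp add: D_nonzero[OF assms] divide_simps power2_eq_square power3_eq_cube,
      insert u_def[of p] v_def[of p] u_add_v[OF assms] D_def[of p] sum_eq_2_complex, algebra)

lemma contraction_bar_2:
  assumes "p \<noteq> 0"
  shows "metric p $ 2 $ 2 * dzbar 1 (\<lambda>q. metric q $ 1 $ 2) p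
    - metric p $ 1 $ 2 * dzbar 1 (\<lambda>q. metric q $ 2 $ 2) p
    - metric p $ 2 $ 1 * dzbar 2 (\<lambda>q. metric q $ 1 $ 2) p
    + metric p $ 1 $ 1 * dzbar 2 (\<lambda>q. metric q $ 2 $ 2) p = 0"
  unfolding metric_derivs[OF assms] unfolding metric_nth
  by (simp add: D_nonzero[OF assms] divide_simps power2_eq_square power3_eq_cube,
      insert u_def[of p] v_def[of p] u_add_v[OF assms] D_def[of p] sum_eq_2_complex, algebra)

lemma det_deriv_bar_2:
  assumes "p \<noteq> 0"
  shows "metric p $ 2 $ 2 * dzbar 2 (\<lambda>q. metric q $ 1 $ 1) p
    - metric p $ 2 $ 1 * dzbar 2 (\<lambda>q. metric q $ 1 $ 2) p
    - metric p $ 1 $ 2 * dzbar 2 (\<lambda>q. metric q $ 2 $ 1) p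
    + metric p $ 1 $ 1 * dzbar 2 (\<lambda>q. metric q $ 2 $ 2) p = 2 * det_metric p * half_dlogdet_2 p"
  unfolding metric_derivs[OF assms] unfolding metric_nth half_dlogdet_2_def det_metric_def
  by (simp add: D_nonzero[OF assms] divide_simps power2_eq_square power3_eq_cube,
      insert u_def[of p] v_def[of p] u_add_v[OF assms] D_def[of p] sum_eq_2_complex, algebra)

text \<open>Half of the trace is the logarithmic derivative of the determinant, from
  \<open>det_deriv_1\<close>; the other half is the vanishing contraction.\<close>

lemma trace_Gamma_1:
  assumes "p \<noteq> 0"
  shows "(\<Sum>k\<in>UNIV. lc_Gamma metric 1 k k p) = cnj (half_dlogdet_1 p)"
  unfolding sum_2 lc_Gamma_def h_inv_def matrix_inv_2[OF det_metric[OF assms] det_metric_nonzero[OF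
      assms]]
  using det_metric_nonzero[OF assms] det_deriv_1[OF assms] contraction_1[OF assms]
  by (simp add: divide_simps) algebra

lemma trace_Gamma_bar_1:
  assumes "p \<noteq> 0"
  shows "(\<Sum>k\<in>UNIV. lc_Gamma_bar metric 1 k k p) = half_dlogdet_1 p"
  unfolding sum_2 lc_Gamma_bar_def h_inv_def matrix_inv_2[OF det_metric[OF assms]
      det_metric_nonzero[OF assms]]
  using det_metric_nonzero[OF assms] det_deriv_bar_1[OF assms] contraction_bar_1[OF assms]
  by (simp add: divide_simps) algebra

lemma trace_Gamma_2:
  assumes "p \<noteq> 0"
  shows "(\<Sum>k\<in>UNIV. lc_Gamma metric 2 k k p) = cnj (half_dlogdet_2 p)"
  unfolding sum_2 lc_Gamma_def h_inv_def matrix_inv_2[OF det_metric[OF assms] det_metric_nonzero[OF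
      assms]]
  using det_metric_nonzero[OF assms] det_deriv_2[OF assms] contraction_2[OF assms]
  by (simp add: divide_simps) algebra

lemma trace_Gamma_bar_2:
  assumes "p \<noteq> 0"
  shows "(\<Sum>k\<in>UNIV. lc_Gamma_bar metric 2 k k p) = half_dlogdet_2 p"
  unfolding sum_2 lc_Gamma_bar_def h_inv_def matrix_inv_2[OF det_metric[OF assms]
      det_metric_nonzero[OF assms]]
  using det_metric_nonzero[OF assms] det_deriv_bar_2[OF assms] contraction_bar_2[OF assms]
  by (simp add: divide_simps) algebra

section \<open>Smoothness of the metric and its Christoffel symbols\<close>

lemma smooth_on_E: "smooth_on (- {0}) E" and smooth_on_F: "smooth_on (- {0}) F"
  unfolding E_def[abs_def] F_def[abs_def]
  by (intro smooth_on_exp smooth_on_mult smooth_on_const open_punctured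
      smooth_on_compose_bounded_linear[OF open_punctured bounded_linear_of_real smooth_on_potential])+

lemma smooth_on_nth: "smooth_on (- {0}) (\<lambda>q :: complex^2. q $ i)"
  by (intro smooth_on_bounded_linear open_punctured bounded_linear_vec_nth)

lemma smooth_on_cnj_nth: "smooth_on (- {0}) (\<lambda>q :: complex^2. cnj (q $ i))"
  by (intro smooth_on_compose_bounded_linear[OF open_punctured bounded_linear_cnj] smooth_on_nth)

lemma smooth_on_metric_nth: "smooth_on (- {0}) (\<lambda>q. metric q $ i $ j)"
proof -
  have "i = 1 \<or> i = 2" "j = 1 \<or> j = 2"
    using exhaust_2 by auto
  then show ?thesis
    unfolding D_def u_def v_def
    by (elim disjE) (simp_all only: metric_nth D_def u_def v_def,
        (intro smooth_on_mult smooth_on_add smooth_on_diff smooth_on_const smooth_on_E smooth_on_F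
          smooth_on_nth smooth_on_cnj_nth open_punctured)+)
qed

lemma smooth_on_metric: "smooth_on (- {0}) metric"
  by (intro smooth_on_matrix open_punctured smooth_on_metric_nth)

lemma smooth_on_h_inv_metric: "smooth_on (- {0}) (h_inv metric k l)"
  unfolding h_inv_def[abs_def]
  by (rule smooth_on_matrix_inv_2[OF open_punctured smooth_on_metric_nth])
    (simp add: det_metric det_metric_nonzero)

lemma smooth_on_lc_Gamma_metric: "smooth_on (- {0}) (lc_Gamma metric i j k)"
  unfolding lc_Gamma_def[abs_def]
  by (intro smooth_on_mult smooth_on_add smooth_on_sum smooth_on_const smooth_on_h_inv_metric
      smooth_on_dz smooth_on_metric_nth open_punctured)

lemma smooth_on_lc_Gamma_bar_metric: "smooth_on (- {0}) (lc_Gamma_bar metric i j k)"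
  unfolding lc_Gamma_bar_def[abs_def]
  by (intro smooth_on_mult smooth_on_diff smooth_on_sum smooth_on_const smooth_on_h_inv_metric
      smooth_on_dzbar smooth_on_metric_nth open_punctured)

lemma lc_ricci_metric:
  assumes "p \<noteq> 0"
  shows "lc_ricci metric p = 0"
proof -
  have p: "p \<in> - {0}"
    using assms by simp
  obtain b1 b2 c1 c2 where
    w: "has_wirtinger half_dlogdet_1 (chi p * (\<beta>\<^sup>2 * E p * v p / D p ^ 3))
      (chi p * (- \<alpha> * \<beta> * p $ 1 * cnj (p $ 2) * E p * F p / D p ^ 3)) b1 b2 p"
    "has_wirtinger half_dlogdet_2 (chi p * (- \<alpha> * \<beta> * cnj (p $ 1) * p $ 2 * E p * F p / D p ^ 3))
      (chi p * (\<alpha>\<^sup>2 * F p * u p / D p ^ 3)) c1 c2 p"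
    using has_wirtinger_half_dlogdet_1[OF assms] has_wirtinger_half_dlogdet_2[OF assms] by blast
  \<comment> \<open>The trace formulas hold at every nonzero point, hence near \<open>p\<close>, and
    so survive differentiation.\<close>
  have tr: "dz i (\<lambda>q. \<Sum>k\<in>UNIV. lc_Gamma_bar metric 1 k k q) p = dz i half_dlogdet_1 p"
    "dz i (\<lambda>q. \<Sum>k\<in>UNIV. lc_Gamma_bar metric 2 k k q) p = dz i half_dlogdet_2 p"
    "dzbar i (\<lambda>q. \<Sum>k\<in>UNIV. lc_Gamma metric 1 k k q) p = dzbar i (\<lambda>q. cnj (half_dlogdet_1 q)) p"
    "dzbar i (\<lambda>q. \<Sum>k\<in>UNIV. lc_Gamma metric 2 k k q) p = dzbar i (\<lambda>q. cnj (half_dlogdet_2 q)) p" for i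
    by (rule dz_cong_open[OF open_punctured p];
        simp add: trace_Gamma_1 trace_Gamma_2 trace_Gamma_bar_1 trace_Gamma_bar_2)+
  have ricci: "lc_ricci metric p $ i $ j =
    dz i (\<lambda>q. \<Sum>k\<in>UNIV. lc_Gamma_bar metric j k k q) p - dzbar j (\<lambda>q.
        \<Sum>k\<in>UNIV. lc_Gamma metric i k k q) p" for i j
    by (intro lc_ricci_eq_traces smooth_on_imp_differentiable[OF _ p]
        smooth_on_lc_Gamma_metric smooth_on_lc_Gamma_bar_metric)
  \<comment> \<open>Entry (i, j) is now chi \<phi>_{i jbar} minus the conjugate of chi \<phi>_{j
    ibar}. The Hessian is Hermitian, so reality of \<open>chi\<close> makes the difference
    zero.\<close>
  have "cnj (chi p) = chi p"
    by (simp add: chi_def)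
  then show ?thesis
    by (simp add: vec_eq_iff forall_2 ricci tr has_wirtinger_imp_dz[OF w(1)] has_wirtinger_imp_dz[OF
        w(2)]
        has_wirtinger_imp_dz[OF has_wirtinger_cnj[OF w(1)]] has_wirtinger_imp_dz[OF
            has_wirtinger_cnj[OF w(2)]])
qed

section \<open>Positivity and invariance under the deck group\<close>

lemma hermitian_metric_on_metric: "hermitian_metric_on (- {0}) metric"
  unfolding hermitian_metric_on_def
proof (intro conjI ballI allI impI)
  show "smooth_on (- {0}) metric"
    by (rule smooth_on_metric)
  fix p :: "complex^2" assume "p \<in> - {0}"
  then have p: "p \<noteq> 0"
    by simp
  show "metric p $ j $ i = cnj (metric p $ i $ j)" for i j
    using exhaust_2[of i] exhaust_2[of j] by (auto simp: metric_nth)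
  fix x :: "complex^2" assume x: "x \<noteq> 0"
  \<comment> \<open>\<open>N\<close> and \<open>M\<close> are eta and xi evaluated on
    \<open>x\<close>; the Hermitian form of \<open>x\<close> is (1/2) E F |N|^2 + D |M|^2.\<close>
  define N where "N = \<beta> * p $ 2 * x $ 1 - \<alpha> * p $ 1 * x $ 2"
  define M where "M = cnj (p $ 1) * E p * x $ 1 + cnj (p $ 2) * F p * x $ 2"
  have "N \<noteq> 0 \<or> M \<noteq> 0"
  proof (rule ccontr)
    assume "\<not> (N \<noteq> 0 \<or> M \<noteq> 0)"
    \<comment> \<open>Cramer's rule for recovering \<open>x\<close> from \<open>N\<close> and
      \<open>M\<close>: the determinant of eta and xi is D, which is nonzero.\<close>
    moreover have "D p * x $ 1 = \<alpha> * p $ 1 * M + cnj (p $ 2) * F p * N"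
      "D p * x $ 2 = \<beta> * p $ 2 * M - cnj (p $ 1) * E p * N"
      by (simp_all add: N_def M_def D_def u_def v_def algebra_simps)
    ultimately show False
      using D_nonzero[OF p] x by (simp add: vec_eq_iff forall_2)
  qed
  then have "norm N > 0 \<or> norm M > 0"
    by simp
  then have "exp (- \<alpha> * \<phi> p) * exp (- \<beta> * \<phi> p) * (norm N)\<^sup>2 / 2 + slope
      p (\<phi> p) * (norm M)\<^sup>2 > 0" (is "?r > 0")
    using slope_pos[OF p, of "\<phi> p"]
    by (elim disjE) (intro add_pos_nonneg add_nonneg_pos divide_pos_pos mult_pos_pos
        mult_nonneg_nonneg; simp)+
  moreover have "(\<Sum>i\<in>UNIV. \<Sum>j\<in>UNIV. metric p $ i $ j * x $ i * cnj (x $ j)) = of_real ?r"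
  proof -
    have r: "of_real ?r = E p * F p * (N * cnj N) / 2 + D p * (M * cnj M)"
      unfolding complex_norm_square[symmetric] by (simp add: E_eq_of_real F_eq_of_real D_eq_slope)
    show ?thesis
      unfolding r unfolding sum_2 metric_nth N_def M_def
      by (simp add: u_def v_def field_simps power2_eq_square)
  qed
  ultimately show "Re (\<Sum>i\<in>UNIV. \<Sum>j\<in>UNIV. metric p $ i $ j * x $ i * cnj (x $ j)) > 0"
    by simp
qed

text \<open>The generator shifts \<phi> by the constant \<open>s\<close>. This divides E by |a|^2
  and F by |b|^2, so \<open>u\<close>, \<open>v\<close> and \<open>D\<close> are invariant and the
  remaining factors cancel those of the pullback.\<close>

lemma pullback_form_metric:
  assumes "p \<noteq> 0" "a \<noteq> 0" "b \<noteq> 0" and s: "exp (\<alpha> * s) = (norm a)\<^sup>2" "exp (\<beta> * s) = (norm b)\<^sup>2"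
  shows "pullback_form (hopf_gen a b) metric p = metric p"
proof -
  define g where "g = hopf_gen a b p"
  have g: "g $ 1 = a * p $ 1" "g $ 2 = b * p $ 2" "g \<noteq> 0"
    using assms(1-3) by (auto simp: g_def hopf_gen_def vec_eq_iff forall_2)
  have "level g (\<phi> p + s) = level p (\<phi> p)"
    using assms(2,3)
    by (simp add: level_def g exp_add[symmetric] exp_diff distrib_left s norm_mult power_mult_distrib
        flip: power2_norm_eq_inner)
  \<comment> \<open>Both numbers put \<open>g\<close> at level 1, and strict monotonicity allows
    only one such value.\<close>
  then have \<phi>g: "\<phi> g = \<phi> p + s"
    using level_potential[OF g(3)] level_potential[OF assms(1)]
      level_strict_antimono[OF g(3), of "\<phi> g" "\<phi> p + s"] level_strict_antimono[OF g(3), of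
          "\<phi> p + s" "\<phi> g"]
    by (cases "\<phi> g" "\<phi> p + s" rule: linorder_cases) auto
  have "E g = E p / of_real (exp (\<alpha> * s))" "F g = F p / of_real (exp (\<beta> * s))"
    by (simp_all add: E_eq_of_real F_eq_of_real \<phi>g distrib_left exp_diff)
  then have EF: "E g = E p / (a * cnj a)" "F g = F p / (b * cnj b)"
    unfolding s complex_norm_square .
  have uvD: "u g = u p" "v g = v p" "D g = D p"
    using assms(2,3) by (simp_all add: u_def v_def D_def g EF)
  have w: "has_wirtinger (\<lambda>q. hopf_gen a b q $ 1) a 0 0 0 p" "has_wirtinger (\<lambda>q.
      hopf_gen a b q $ 2) 0 b 0 0 p"
    using has_wirtinger_mult[OF has_wirtinger_const has_wirtinger_nth(1), of a p]
      has_wirtinger_mult[OF has_wirtinger_const has_wirtinger_nth(2), of b p]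
    by (simp_all add: hopf_gen_def)
  show ?thesis
    using assms(2,3)
    by (simp add: pullback_form_def vec_eq_iff forall_2 sum_2 has_wirtinger_imp_dz[OF w(1)]
        has_wirtinger_imp_dz[OF w(2)] flip: g_def)
      (simp add: metric_nth EF uvD g)
qed

end

section \<open>Existence and uniqueness of \<theta>\<close>

lemma hopf_theta_eq_ex1:
  assumes "norm a \<ge> norm b" "norm b > 1" "p \<noteq> 0"
  shows "\<exists>!t. hopf_theta_eq a b p t"
proof (rule ex_ex1I)
  define A where "A = (norm (p $ 1))\<^sup>2"
  define B where "B = (norm (p $ 2))\<^sup>2"
  define g where "g t = A * exp (- hopf_k a * t / pi) + B * exp (- hopf_k b * t / pi)" for t
  have eq: "hopf_theta_eq a b p t \<longleftrightarrow> g t = 1" for t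
    by (simp add: hopf_theta_eq_def g_def A_def B_def)
  have "norm b > 0" "norm a > 0"
    using assms(1,2) by linarith+
  then have k: "hopf_k b > 0" "hopf_k a \<ge> hopf_k b"
    using assms(1,2) by (simp_all add: hopf_k_def ln_gt_zero del: zero_less_norm_iff)
  have AB: "A \<ge> 0" "B \<ge> 0" "A > 0 \<or> B > 0"
    using assms(3) by (auto simp: A_def B_def vec_eq_iff forall_2)
  have anti: "g t < g s" if "s < t" for s t
  proof -
    have "exp (- hopf_k a * t / pi) < exp (- hopf_k a * s / pi)" "exp (- hopf_k b * t / pi) < exp (-
        hopf_k b * s / pi)"
      using that k by (simp_all add: divide_strict_right_mono)
    then show ?thesis
      using AB unfolding g_def by (smt (verit) mult_left_mono mult_strict_left_mono)
  qed
  have cont: "continuous_on S g" for S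
    unfolding g_def by (intro continuous_intros) auto
  \<comment> \<open>\<open>t0\<close> solves the equation with both exponents set to the smaller
    rate \<open>hopf_k b\<close>. Restoring \<open>hopf_k a\<close> in the first term moves
    \<open>g t0\<close> to the opposite side of 1 from \<open>g 0 = A + B\<close>, in the weak
    sense, so the intermediate value theorem applies between 0 and \<open>t0\<close>.\<close>
  define t0 where "t0 = pi * ln (A + B) / hopf_k b"
  have t0: "(A + B) * exp (- hopf_k b * t0 / pi) = 1"
    using k AB by (simp add: t0_def exp_minus field_simps) linarith
  show "\<exists>t. hopf_theta_eq a b p t"
  proof (cases "A + B \<ge> 1")
    case True
    then have "t0 \<ge> 0"
      using k by (simp add: t0_def)
    then have "exp (- hopf_k a * t0 / pi) \<le> exp (- hopf_k b * t0 / pi)"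
      using k by (simp add: divide_right_mono mult_right_mono)
    then have "A * exp (- hopf_k a * t0 / pi) \<le> A * exp (- hopf_k b * t0 / pi)"
      using AB by (intro mult_left_mono)
    then have "g t0 \<le> 1"
      using t0 unfolding g_def distrib_right by linarith
    then show ?thesis
      using IVT2'[of g t0 1 0] True \<open>t0 \<ge> 0\<close> cont unfolding eq by (auto simp: g_def)
  next
    case False
    then have "t0 \<le> 0"
      using k AB by (auto simp: t0_def divide_le_0_iff mult_le_0_iff)
    then have "exp (- hopf_k b * t0 / pi) \<le> exp (- hopf_k a * t0 / pi)"
      using k by (simp add: divide_right_mono mult_right_mono_neg)
    then have "A * exp (- hopf_k b * t0 / pi) \<le> A * exp (- hopf_k a * t0 / pi)"
      using AB by (intro mult_left_mono)
    then have "g t0 \<ge> 1"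
      using t0 unfolding g_def distrib_right by linarith
    then show ?thesis
      using IVT2'[of g 0 1 t0] False \<open>t0 \<le> 0\<close> cont unfolding eq by (auto simp: g_def)
  qed
  show "s = t" if "hopf_theta_eq a b p s" "hopf_theta_eq a b p t" for s t
    using that anti[of s t] anti[of t s] unfolding eq by (cases s t rule: linorder_cases) auto
qed

section \<open>Specialisation of the potential to the Hopf data\<close>

theorem theorem1p6:
  fixes a b :: complex
  assumes "norm a \<ge> norm b" and "norm b > 1"
  shows "(\<forall>p. p \<noteq> 0 \<longrightarrow> (\<exists>!t. hopf_theta_eq a b p t)) \<and>
         smooth_on (- {0}) (hopf_theta a b) \<and>
         hermitian_metric_on_hopf a b (hopf_metric a b) \<and>
         lc_ricci_flat_on_hopf a b (hopf_metric a b)"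
proof -
  define k where "k = hopf_k a + hopf_k b"
  define \<beta> where "\<beta> = 2 * hopf_k b / k"
  define \<phi> where "\<phi> p = k / (2 * pi) * hopf_theta a b p" for p
  have k: "hopf_k a > 0" "hopf_k b > 0" "k > 0"
    using assms by (auto simp: hopf_k_def k_def intro!: add_pos_pos ln_gt_zero)
  have \<alpha>: "hopf_alpha a b = 2 * hopf_k a / k"
    by (simp add: hopf_alpha_def k_def)
  have \<beta>: "\<beta> = 2 - hopf_alpha a b"
    using k by (simp add: \<alpha> \<beta>_def k_def field_simps)
  \<comment> \<open>These rescalings turn the equation defining \<theta> into the implicit equation
    of the locale.\<close>
  have \<alpha>\<phi>: "- hopf_alpha a b * \<phi> p = - hopf_k a * hopf_theta a b p / pi"
    and \<beta>\<phi>: "- \<beta> * \<phi> p = - hopf_k b * hopf_theta a b p / pi" for p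
    using k by (simp_all add: \<alpha> \<beta>_def \<phi>_def)
  have theta: "hopf_theta_eq a b p (hopf_theta a b p)" if "p \<noteq> 0" for p
    unfolding hopf_theta_def by (rule theI'[OF hopf_theta_eq_ex1[OF assms that]])
  interpret hopf_potential "hopf_alpha a b" \<beta> \<phi>
  proof
    show "hopf_alpha a b > 0" "\<beta> > 0"
      using k by (simp_all add: \<alpha> \<beta>_def)
    show "hopf_alpha a b + \<beta> = 2"
      by (simp add: \<beta>)
    show "(norm (p $ 1))\<^sup>2 * exp (- hopf_alpha a b * \<phi> p) + (norm (p $ 2))\<^sup>2 * exp (- \<beta> * \<phi> p) = 1"
      if "p \<noteq> 0" for p
      using theta[OF that] unfolding hopf_theta_eq_def \<alpha>\<phi> \<beta>\<phi> .
  qed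
  have Phi: "hopf_Phi a b = (\<lambda>p. exp (\<phi> p))"
    by (simp add: fun_eq_iff hopf_Phi_def \<phi>_def k_def)
  have Delta: "hopf_Delta a b p = slope p (\<phi> p)" for p
  proof -
    have "hopf_alpha a b - 2 = - \<beta>"
      by (simp add: \<beta>)
    then show ?thesis
      by (simp add: hopf_Delta_def slope_def Phi powr_def power2_norm_eq_inner flip: \<beta>)
  qed
  \<comment> \<open>Since ln Phi = \<phi>, the closed form applies off the origin; this set is open,
    so the agreement carries smoothness and curvature across.\<close>
  have metric: "hopf_metric a b p = metric p" if "p \<noteq> 0" for p
    using metric_eq_ddbar[OF that]
    by (simp add: hopf_metric_def Phi Delta vec_eq_iff D_eq_slope)
  have "smooth_on (- {0}) (\<lambda>p. 2 * pi / k * \<phi> p)"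
    by (intro smooth_on_mult smooth_on_const smooth_on_potential open_punctured)
  moreover have "(\<lambda>p. 2 * pi / k * \<phi> p) = hopf_theta a b"
    using k by (simp add: \<phi>_def fun_eq_iff)
  ultimately have "smooth_on (- {0}) (hopf_theta a b)"
    by (simp only:)
  moreover have "hermitian_metric_on (- {0}) (hopf_metric a b)"
    by (rule hermitian_metric_on_cong[OF open_punctured _ hermitian_metric_on_metric]) (simp add:
        metric)
  moreover have "pullback_form (hopf_gen a b) (hopf_metric a b) p = hopf_metric a b p" if "p \<noteq> 0" for p
  proof -
    have nz: "a \<noteq> 0" "b \<noteq> 0"
      using assms by auto
    \<comment> \<open>The shift of \<phi> is \<open>k\<close>, that is \<theta> increases by 2 pi:
      \<alpha> k = 2 log |a| and \<beta> k = 2 log |b|.\<close>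
    have exp: "exp (hopf_alpha a b * k) = (norm a)\<^sup>2" "exp (\<beta> * k) = (norm b)\<^sup>2"
      using k nz by (simp_all add: \<alpha> \<beta>_def hopf_k_def exp_double)
    \<comment> \<open>The pullback evaluates the metric at the image point, where the closed form
      again requires a nonzero argument.\<close>
    have "hopf_gen a b p \<noteq> 0"
      using nz that by (auto simp: hopf_gen_def vec_eq_iff forall_2)
    then show ?thesis
      using pullback_form_metric[OF that nz exp] that by (simp add: pullback_form_def metric)
  qed
  moreover have "lc_ricci (hopf_metric a b) p = 0" if "p \<noteq> 0" for p
    using lc_ricci_cong_open[OF open_punctured, of p "hopf_metric a b" metric] metric
        lc_ricci_metric[OF that] that
    by simp
  then have "lc_ricci_flat_on_hopf a b (hopf_metric a b)"
    by (auto simp: lc_ricci_flat_on_hopf_def hopf_surface_def hopf_rel_def quotient_def)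
  ultimately show ?thesis
    using hopf_theta_eq_ex1[OF assms] by (simp add: hermitian_metric_on_hopf_def)
qed

end
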